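(* Let $G$ be a chordal graph with vertex set $\{1,\dots,n\}$. Then a minimal polynomial of the hyperbolicity cone $\mathcal{S}^*(G)$ is $$p_G(X)=\prod_{C \text{ maximal clique of } G} \det(X_C),$$ where $X$ is a symmetric matrix of unknowns (ranging over $\mathcal{S}(G)$) and $X_C$ denotes the principal submatrix of $X$ indexed by the vertices of $C$.
   Context: Graphs are finite, simple and undirected. $\mathcal{S}^n$ is the space of real symmetric $n\times n$ matrices. For a graph $G$ with vertices $\{1,\dots,n\}$ and edge set $E$, put $\mathcal{S}(G)=\{X\in\mathcal{S}^n \mid X_{ij}=0 \text{ for all } i\neq j \text{ with } \{i,j\}\notin E\}$ and $\mathcal{S}^*(G)=\{A\in\mathcal{S}(G)\mid A_C\succeq 0 \text{ for all cliques } C \text{ of } G\}$, where $A_C$ is the principal submatrix indexed by the vertices of $C$. A graph is chordal if every cycle of length at least 4 has a chord. Maximal cliques are maximal with respect to inclusion. A homogeneous polynomial $p$ on a finite-dimensional real Euclidean space $\mathcal{V}$ is hyperbolic along $e\in\mathcal{V}$ if $p(e)>0$ and for every $x\in\mathcal{V}$ the univariate polynomial $t\mapsto p(x-te)$ has only real roots; its hyperbolicity cone is $\Lambda_+(p,e)=\{x\in\mathcal{V}\mid \text{all roots of } t\mapsto p(te-x) \text{ are nonnegative}\}$. A cone is a hyperbolicity cone if it equals some $\Lambda_+(p,e)$. Here $\mathcal{V}=\mathcal{S}(G)$. A minimal polynomial of a closed semialgebraic convex cone $K\subsetneq\mathcal{V}$ with nonempty interior in $\mathcal{V}$ is a nonzero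 polynomial on $\mathcal{V}$ of minimal degree vanishing on the boundary of $K$ (it is unique up to scaling and divides every polynomial vanishing on the boundary). For a hyperbolicity cone $K$, the minimal polynomials (up to sign) are exactly the hyperbolic polynomials $p$ of minimal degree with $K=\Lambda_+(p,e)$. *)

theory Defs
  imports "HOL-Analysis.Analysis" "HOL-Computational_Algebra.Polynomial"
begin

section \<open>Graphs on the vertex set UNIV of a finite type\<close>

definition simple_graph :: "'n set set \<Rightarrow> bool" where
  "simple_graph E \<longleftrightarrow> (\<forall>e\<in>E. card e = 2)"

definition clique :: "'n set set \<Rightarrow> 'n set \<Rightarrow> bool" where
  "clique E C \<longleftrightarrow> (\<forall>i\<in>C. \<forall>j\<in>C. i \<noteq> j \<longrightarrow> {i, j} \<in> E)"

definition maximal_cliques :: "'n set set \<Rightarrow> 'n set set" where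
  "maximal_cliques E = {C. clique E C \<and> (\<forall>D. clique E D \<longrightarrow> C \<subseteq> D \<longrightarrow> D = C)}"

definition cycle_edges :: "'n list \<Rightarrow> 'n set set" where
  "cycle_edges c = {{c ! i, c ! (Suc i mod length c)} | i. i < length c}"

definition is_cycle :: "'n set set \<Rightarrow> 'n list \<Rightarrow> bool" where
  "is_cycle E c \<longleftrightarrow> length c \<ge> 3 \<and> distinct c \<and> cycle_edges c \<subseteq> E"

definition chordal :: "'n set set \<Rightarrow> bool" where
  "chordal E \<longleftrightarrow>
    (\<forall>c. is_cycle E c \<and> length c \<ge> 4 \<longrightarrow> (\<exists>e\<in>E. e \<subseteq> set c \<and> e \<notin> cycle_edges c))"

section \<open>Principal submatrices, and the cone of a graph\<close>

text \<open>The principal submatrix \<open>A\<^sub>C\<close> is not formed as a separate object, since its index set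
  is a set and not a type; its determinant is the Leibniz formula over the index set \<open>C\<close>, i.e.
  the library definition of \<open>det\<close> with \<open>C\<close> in place of \<open>UNIV\<close>.\<close>

definition principal_det :: "'n set \<Rightarrow> real^'n^'n \<Rightarrow> real" where
  "principal_det C A =
    (\<Sum>\<pi> | \<pi> permutes C. of_int (sign \<pi>) * (\<Prod>i\<in>C. A $ i $ \<pi> i))"

lemma principal_det_UNIV: "principal_det UNIV A = det A"
  by (simp add: principal_det_def det_def)

definition principal_psd :: "'n set \<Rightarrow> real^'n^'n \<Rightarrow> bool" where
  "principal_psd C A \<longleftrightarrow>
    (\<forall>i\<in>C. \<forall>j\<in>C. A $ i $ j = A $ j $ i) \<and>
    (\<forall>x :: 'n \<Rightarrow> real. (\<Sum>i\<in>C. \<Sum>j\<in>C. x i * A $ i $ j * x j) \<ge> 0)"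

definition graph_matrices :: "'n set set \<Rightarrow> (real^'n^'n) set" where
  "graph_matrices E =
    {X. transpose X = X \<and> (\<forall>i j. i \<noteq> j \<longrightarrow> {i, j} \<notin> E \<longrightarrow> X $ i $ j = 0)}"

definition clique_psd_cone :: "'n set set \<Rightarrow> (real^'n^'n) set" where
  "clique_psd_cone E = {A \<in> graph_matrices E. \<forall>C. clique E C \<longrightarrow> principal_psd C A}"

definition clique_poly :: "'n set set \<Rightarrow> real^'n^'n \<Rightarrow> real" where
  "clique_poly E X = (\<Prod>C\<in>maximal_cliques E. principal_det C X)"

section \<open>Polynomials on a linear subspace\<close>

text \<open>Polynomials on a subspace \<open>V\<close> are identified with polynomial functions on \<open>V\<close> (the field is
  infinite). Each of them is the restriction of a polynomial on the ambient space of the same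
  degree, so they are written in the ambient coordinates; only the values on \<open>V\<close> matter.
  A multi-index is a function on \<open>Basis\<close>.\<close>

definition polynomial_le_on :: "'a::euclidean_space set \<Rightarrow> nat \<Rightarrow> ('a \<Rightarrow> real) \<Rightarrow> bool" where
  "polynomial_le_on V d f \<longleftrightarrow>
    (\<exists>a :: ('a \<Rightarrow> nat) \<Rightarrow> real. \<forall>x\<in>V.
      f x = (\<Sum>\<alpha> | \<alpha> \<in> Basis \<rightarrow>\<^sub>E {..d} \<and> sum \<alpha> Basis \<le> d. a \<alpha> * (\<Prod>b\<in>Basis. (x \<bullet> b) ^ \<alpha> b)))"

definition homogeneous_on :: "'a::euclidean_space set \<Rightarrow> nat \<Rightarrow> ('a \<Rightarrow> real) \<Rightarrow> bool" where
  "homogeneous_on V d f \<longleftrightarrow>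
    (\<exists>a :: ('a \<Rightarrow> nat) \<Rightarrow> real. \<forall>x\<in>V.
      f x = (\<Sum>\<alpha> | \<alpha> \<in> Basis \<rightarrow>\<^sub>E {..d} \<and> sum \<alpha> Basis = d. a \<alpha> * (\<Prod>b\<in>Basis. (x \<bullet> b) ^ \<alpha> b)))"

definition polynomial_on :: "'a::euclidean_space set \<Rightarrow> ('a \<Rightarrow> real) \<Rightarrow> bool" where
  "polynomial_on V f \<longleftrightarrow> (\<exists>d. polynomial_le_on V d f)"

definition degree_on :: "'a::euclidean_space set \<Rightarrow> ('a \<Rightarrow> real) \<Rightarrow> nat" where
  "degree_on V f = (LEAST d. polynomial_le_on V d f)"

section \<open>Hyperbolic polynomials\<close>

definition real_rooted :: "real poly \<Rightarrow> bool" where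
  "real_rooted u \<longleftrightarrow> (\<forall>z::complex. poly (map_poly complex_of_real u) z = 0 \<longrightarrow> z \<in> \<real>)"

definition hyperbolic_along ::
  "'a::euclidean_space set \<Rightarrow> ('a \<Rightarrow> real) \<Rightarrow> 'a \<Rightarrow> bool" where
  "hyperbolic_along V p e \<longleftrightarrow>
    (\<exists>d. homogeneous_on V d p) \<and> e \<in> V \<and> p e > 0 \<and>
    (\<forall>x\<in>V. \<exists>u. (\<forall>t. poly u t = p (x - t *\<^sub>R e)) \<and> real_rooted u)"

text \<open>Only used for \<open>p\<close> hyperbolic along \<open>e\<close>, when all roots of \<open>p (t e - x)\<close> are real.\<close>

definition hyp_cone :: "'a::euclidean_space set \<Rightarrow> ('a \<Rightarrow> real) \<Rightarrow> 'a \<Rightarrow> 'a set" where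
  "hyp_cone V p e = {x \<in> V. \<forall>t. p (t *\<^sub>R e - x) = 0 \<longrightarrow> t \<ge> 0}"

definition is_hyperbolicity_cone :: "'a::euclidean_space set \<Rightarrow> 'a set \<Rightarrow> bool" where
  "is_hyperbolicity_cone V K \<longleftrightarrow> (\<exists>p e. hyperbolic_along V p e \<and> K = hyp_cone V p e)"

section \<open>Minimal polynomials\<close>

inductive semialgebraic_in :: "'a::euclidean_space set \<Rightarrow> 'a set \<Rightarrow> bool" for V where
  pos: "polynomial_on V f \<Longrightarrow> semialgebraic_in V {x \<in> V. f x > 0}"
| union: "semialgebraic_in V A \<Longrightarrow> semialgebraic_in V B \<Longrightarrow> semialgebraic_in V (A \<union> B)"
| compl: "semialgebraic_in V A \<Longrightarrow> semialgebraic_in V (V - A)"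

definition nonzero_vanishing_on_boundary ::
  "'a::euclidean_space set \<Rightarrow> 'a set \<Rightarrow> ('a \<Rightarrow> real) \<Rightarrow> bool" where
  "nonzero_vanishing_on_boundary V K p \<longleftrightarrow>
    polynomial_on V p \<and> (\<exists>x\<in>V. p x \<noteq> 0) \<and> (\<forall>x \<in> top_of_set V frontier_of K. p x = 0)"

text \<open>The standing assumptions on \<open>V\<close> and \<open>K\<close> are part of the predicate; topological notions are
  relative to \<open>V\<close>.\<close>

definition is_minimal_polynomial ::
  "'a::euclidean_space set \<Rightarrow> 'a set \<Rightarrow> ('a \<Rightarrow> real) \<Rightarrow> bool" where
  "is_minimal_polynomial V K p \<longleftrightarrow>
    subspace V \<and> K \<subset> V \<and> closedin (top_of_set V) K \<and> semialgebraic_in V K \<and>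
    convex K \<and> cone K \<and> top_of_set V interior_of K \<noteq> {} \<and>
    nonzero_vanishing_on_boundary V K p \<and>
    (\<forall>q. nonzero_vanishing_on_boundary V K q \<longrightarrow> degree_on V p \<le> degree_on V q)"

end

theory Submission
  imports Defs
begin

text \<open>If a polynomial \<open>q\<close> vanishes on the boundary of the cone, it vanishes wherever some \<open>det X\<^sub>C\<close> with
  \<open>C\<close> a maximal clique does. For a vector \<open>v\<close> with full support on \<open>C\<close>, the matrix
  \<open>\<bar>v\<bar>\<^sup>2 I - v v\<^sup>T\<close> is singular on \<open>C\<close> and positive definite on every other clique, so near it all
  \<open>X\<close> with \<open>X\<^sub>C v = 0\<close> lie on the boundary; hence \<open>q\<close> vanishes on the whole linear space of such \<open>X\<close>,
  and by density on all \<open>X\<close> with \<open>det X\<^sub>C = 0\<close>. On the other hand there is \<open>X\<close>, a small perturbation of a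
  diagonal matrix, such that the eigenvalues of all blocks \<open>X\<^sub>C\<close> are pairwise different. On the line
  \<open>t \<mapsto> X - t I\<close>, \<open>q\<close> then has as many zeros as the sum of the sizes of the maximal cliques, which is the
  degree of the clique polynomial.\<close>

text \<open>Full support of \<open>v\<close> keeps the singularity confined to \<open>C\<close>.
  Every other clique \<open>D\<close> misses a vertex of \<open>C\<close>, so \<open>v\<close> is
  strictly shorter on \<open>D\<close> and Cauchy-Schwarz gives definiteness there. If
  \<open>v\<close> had zeros on \<open>C\<close>, the smaller clique carrying its support would be
  singular too, and its minor could turn negative nearby. The obstacle to counting zeros is that a
  diagonal matrix has the same eigenvalue a_i in every clique containing \<open>i\<close>. An
  off-diagonal perturbation \<epsilon> W does not move it at first order, so the cliques have to be
  told apart by the second order term, the sum of - W_ij^2 / (a_j - a_i) over the other vertices j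
  of the clique. Moreover \<open>q\<close> could vanish on the whole line through the matrix found.
  Eigenvalues are therefore recorded as sign changes of determinants on disjoint intervals, which
  survive a small move to a point where \<open>q\<close> is nonzero.\<close>

section \<open>Principal determinants\<close>

text \<open>Entries are a function into any commutative ring because real, complex and polynomial
  entries all occur below, as do blocks shifted or rescaled entrywise.\<close>

definition leibniz_det :: "'n set \<Rightarrow> ('n \<Rightarrow> 'n \<Rightarrow> 'a) \<Rightarrow> 'a::comm_ring_1" where
  "leibniz_det C A = (\<Sum>\<pi> | \<pi> permutes C. of_int (sign \<pi>) * (\<Prod>i\<in>C. A i (\<pi> i)))"

lemma principal_det_leibniz: "principal_det C X = leibniz_det C (\<lambda>i j. X $ i $ j)"
  by (simp add: principal_det_def leibniz_det_def)

lemma leibniz_det_cong: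
  assumes "\<And>i j. i \<in> C \<Longrightarrow> j \<in> C \<Longrightarrow> A i j = B i j"
  shows "leibniz_det C A = leibniz_det C B"
  unfolding leibniz_det_def
  by (intro sum.cong refl arg_cong2[where f = "(*)"] prod.cong)
     (auto simp: assms permutes_in_image)

text \<open>The block is completed by the identity off \<open>C\<close>, so only permutations fixing
  every point off \<open>C\<close> contribute. This carries facts about \<open>det\<close> over to
  an arbitrary index set.\<close>

lemma det_embed_block:
  fixes A :: "'n::finite \<Rightarrow> 'n \<Rightarrow> 'a::comm_ring_1"
  shows "det (\<chi> i j. if i \<in> C \<and> j \<in> C then A i j else if i = j then 1 else 0) = leibniz_det C A"
proof -
  define M where "M = (\<lambda>i j. if i \<in> C \<and> j \<in> C then A i j else if i = j then 1 else (0::'a))"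
  have zero: "(\<Prod>i\<in>UNIV. M i (\<pi> i)) = 0" if \<pi>: "\<pi> permutes UNIV" "\<not> \<pi> permutes C" for \<pi>
  proof -
    obtain i where "i \<notin> C" "\<pi> i \<noteq> i"
      using \<pi> unfolding permutes_def by blast
    then have "M i (\<pi> i) = 0" by (auto simp: M_def)
    then show ?thesis by (auto intro!: prod_zero)
  qed
  have restrict: "(\<Prod>i\<in>UNIV. M i (\<pi> i)) = (\<Prod>i\<in>C. A i (\<pi> i))" if "\<pi> permutes C" for \<pi>
  proof -
    have "(\<Prod>i\<in>UNIV. M i (\<pi> i)) = (\<Prod>i\<in>C. M i (\<pi> i))"
      by (rule prod.mono_neutral_right) (use that in \<open>auto simp: M_def permutes_def\<close>)
    also have "\<dots> = (\<Prod>i\<in>C. A i (\<pi> i))"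
      by (rule prod.cong) (use that in \<open>auto simp: M_def permutes_in_image\<close>)
    finally show ?thesis .
  qed
  have "(\<Sum>\<pi> | \<pi> permutes UNIV. of_int (sign \<pi>) * (\<Prod>i\<in>UNIV. M i (\<pi> i)))
      = (\<Sum>\<pi> | \<pi> permutes C. of_int (sign \<pi>) * (\<Prod>i\<in>UNIV. M i (\<pi> i)))"
    by (rule sum.mono_neutral_right) (auto simp: zero intro: permutes_subset finite_permutations)
  also have "\<dots> = leibniz_det C A"
    unfolding leibniz_det_def by (rule sum.cong) (auto simp: restrict)
  finally show ?thesis by (simp add: det_def M_def)
qed

text \<open>The embedded matrix acts as the identity off \<open>C\<close>, so its kernel vectors
  vanish there and correspond to those of the block.\<close>

lemma leibniz_det_eq_0_iff:
  fixes A :: "'n::finite \<Rightarrow> 'n \<Rightarrow> 'a::field"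
  shows "leibniz_det C A = 0 \<longleftrightarrow>
    (\<exists>v. (\<exists>i\<in>C. v i \<noteq> 0) \<and> (\<forall>i\<in>C. (\<Sum>j\<in>C. A i j * v j) = 0))"
proof -
  define M :: "'a^'n^'n" where
    "M = (\<chi> i j. if i \<in> C \<and> j \<in> C then A i j else if i = j then 1 else 0)"
  have Mv: "(M *v x) $ i = (if i \<in> C then \<Sum>j\<in>C. A i j * x $ j else x $ i)" for x i
  proof (cases "i \<in> C")
    case True
    have "(M *v x) $ i = (\<Sum>j\<in>UNIV. if j \<in> C then A i j * x $ j else 0)"
      unfolding matrix_vector_mult_def M_def using True by (auto intro!: sum.cong)
    then show ?thesis using True by (simp add: sum.If_cases)
  next
    case False
    have "(M *v x) $ i = (\<Sum>j\<in>UNIV. if i = j then x $ j else 0)"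
      unfolding matrix_vector_mult_def M_def vec_lambda_beta using False
      by (intro sum.cong) auto
    then show ?thesis using False by simp
  qed
  have "leibniz_det C A = 0 \<longleftrightarrow> (\<exists>x. M *v x = 0 \<and> x \<noteq> 0)"
    using invertible_det_nz[of M] det_embed_block[of C A] matrix_left_invertible_ker[of M]
    by (auto simp: M_def invertible_left_inverse)
  also have "\<dots> \<longleftrightarrow> (\<exists>v. (\<exists>i\<in>C. v i \<noteq> 0) \<and> (\<forall>i\<in>C. (\<Sum>j\<in>C. A i j * v j) = 0))"
  proof
    assume "\<exists>x. M *v x = 0 \<and> x \<noteq> 0"
    then obtain x where x: "M *v x = 0" "x \<noteq> 0" by blast
    have out: "x $ i = 0" if "i \<notin> C" for i using Mv[of x i] x(1) that by simp
    have "\<exists>i\<in>C. x $ i \<noteq> 0" using x(2) out by (metis vec_eq_iff zero_index)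
    moreover have "\<forall>i\<in>C. (\<Sum>j\<in>C. A i j * x $ j) = 0" using Mv[of x] x(1) by (metis zero_index)
    ultimately show "\<exists>v. (\<exists>i\<in>C. v i \<noteq> 0) \<and> (\<forall>i\<in>C. (\<Sum>j\<in>C. A i j * v j) = 0)" by blast
  next
    assume "\<exists>v. (\<exists>i\<in>C. v i \<noteq> 0) \<and> (\<forall>i\<in>C. (\<Sum>j\<in>C. A i j * v j) = 0)"
    then obtain v k where v: "k \<in> C" "v k \<noteq> 0" "\<forall>i\<in>C. (\<Sum>j\<in>C. A i j * v j) = 0" by blast
    define x where "x = (\<chi> i. if i \<in> C then v i else 0)"
    have "M *v x = 0"
      unfolding vec_eq_iff using v(3) by (auto simp: Mv x_def)
    moreover have "x $ k \<noteq> 0" using v by (simp add: x_def)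
    ultimately show "\<exists>x. M *v x = 0 \<and> x \<noteq> 0" by (metis zero_index)
  qed
  finally show ?thesis .
qed

text \<open>Every permutation picks one entry from each row and each column, so each
  \<open>c i\<close> occurs twice in each term.\<close>

lemma leibniz_det_scale:
  fixes A :: "'n::finite \<Rightarrow> 'n \<Rightarrow> 'a::comm_ring_1"
  shows "leibniz_det C (\<lambda>i j. c i * c j * A i j) = (\<Prod>i\<in>C. c i)\<^sup>2 * leibniz_det C A"
proof -
  have "(\<Prod>i\<in>C. c i * c (\<pi> i) * A i (\<pi> i)) = (\<Prod>i\<in>C. c i)\<^sup>2 * (\<Prod>i\<in>C. A i (\<pi> i))"
    if "\<pi> permutes C" for \<pi>
    using prod.permute[OF that, of c] by (simp add: prod.distrib power2_eq_square o_def)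
  then show ?thesis
    unfolding leibniz_det_def sum_distrib_left
    by (intro sum.cong) (auto simp: mult_ac)
qed

text \<open>The entry at \<open>(k, k)\<close> occurs only in the terms of permutations fixing
  \<open>k\<close>, which are the permutations of \<open>C - {k}\<close>.\<close>

lemma leibniz_det_add_diagonal:
  fixes A :: "'n::finite \<Rightarrow> 'n \<Rightarrow> 'a::comm_ring_1"
  assumes "k \<in> C"
  shows "leibniz_det C (\<lambda>i j. A i j + (if i = k \<and> j = k then t else 0))
       = leibniz_det C A + t * leibniz_det (C - {k}) A"
proof -
  let ?B = "\<lambda>i j. A i j + (if i = k \<and> j = k then t else 0)"
  have pr: "(\<Prod>i\<in>C. ?B i (\<pi> i)) =
      (\<Prod>i\<in>C. A i (\<pi> i)) + (if \<pi> k = k then t * (\<Prod>i\<in>C - {k}. A i (\<pi> i)) else 0)" for \<pi>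
  proof -
    have "(\<Prod>i\<in>C. ?B i (\<pi> i)) = ?B k (\<pi> k) * (\<Prod>i\<in>C - {k}. ?B i (\<pi> i))"
      using assms by (simp add: prod.remove)
    also have "(\<Prod>i\<in>C - {k}. ?B i (\<pi> i)) = (\<Prod>i\<in>C - {k}. A i (\<pi> i))"
      by (rule prod.cong) auto
    finally show ?thesis
      using assms by (simp add: prod.remove[of C k] distrib_right)
  qed
  have fix_k: "{\<pi>. \<pi> permutes C} \<inter> {\<pi>. \<pi> k = k} = {\<pi>. \<pi> permutes (C - {k})}"
    using assms by (auto simp: permutes_def)
  have "leibniz_det C ?B = leibniz_det C A +
     (\<Sum>\<pi> | \<pi> permutes C. if \<pi> k = k then t * (of_int (sign \<pi>) * (\<Prod>i\<in>C - {k}. A i (\<pi> i))) else 0)"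
    unfolding leibniz_det_def pr sum.distrib[symmetric]
    by (rule sum.cong) (auto simp: algebra_simps)
  also have "(\<Sum>\<pi> | \<pi> permutes C. if \<pi> k = k then t * (of_int (sign \<pi>) * (\<Prod>i\<in>C - {k}. A i (\<pi> i))) else 0)
     = t * leibniz_det (C - {k}) A"
    unfolding leibniz_det_def sum_distrib_left fix_k[symmetric]
    by (simp add: sum.inter_restrict finite_permutations)
  finally show ?thesis .
qed

lemma leibniz_det_diagonal_nz:
  fixes A :: "'n::finite \<Rightarrow> 'n \<Rightarrow> 'a::field"
  assumes "\<And>i. i \<in> C \<Longrightarrow> A i i \<noteq> 0" "\<And>i j. i \<in> C \<Longrightarrow> j \<in> C \<Longrightarrow> i \<noteq> j \<Longrightarrow> A i j = 0"
  shows "leibniz_det C A \<noteq> 0"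
proof
  assume "leibniz_det C A = 0"
  then obtain v k where v: "k \<in> C" "v k \<noteq> 0" "\<forall>i\<in>C. (\<Sum>j\<in>C. A i j * v j) = 0"
    by (auto simp: leibniz_det_eq_0_iff)
  have "(\<Sum>j\<in>C. A k j * v j) = (\<Sum>j\<in>C. if j = k then A k k * v k else 0)"
    using assms(2) v(1) by (intro sum.cong) auto
  then show False using v assms(1)[of k] by simp
qed

section \<open>Positive semidefinite principal submatrices\<close>

abbreviation quad_form :: "'n set \<Rightarrow> real^'n^'n \<Rightarrow> ('n \<Rightarrow> real) \<Rightarrow> real" where
  "quad_form C A x \<equiv> \<Sum>i\<in>C. \<Sum>j\<in>C. x i * A $ i $ j * x j"

lemma principal_psdI:
  assumes "\<And>i j. i \<in> C \<Longrightarrow> j \<in> C \<Longrightarrow> A $ i $ j = A $ j $ i" "\<And>x. quad_form C A x \<ge> 0"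
  shows "principal_psd C A"
  using assms by (auto simp: principal_psd_def)

lemma principal_psdD:
  assumes "principal_psd C A"
  shows "i \<in> C \<Longrightarrow> j \<in> C \<Longrightarrow> A $ i $ j = A $ j $ i" "quad_form C A x \<ge> 0"
  using assms by (auto simp: principal_psd_def)

lemma quad_form_alt: "quad_form C A x = (\<Sum>i\<in>C. x i * (\<Sum>j\<in>C. A $ i $ j * x j))"
  by (simp add: sum_distrib_left mult.assoc)

lemma quad_form_superset:
  fixes A :: "real^'n::finite^'n"
  assumes "D \<subseteq> C"
  shows "quad_form D A x = quad_form C A (\<lambda>i. if i \<in> D then x i else 0)"
proof -
  have "quad_form C A (\<lambda>i. if i \<in> D then x i else 0)
      = quad_form D A (\<lambda>i. if i \<in> D then x i else 0)"
    using assms by (intro sum.mono_neutral_cong_right sum.mono_neutral_right)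
      (auto intro!: sum.neutral sum.mono_neutral_right)
  then show ?thesis by simp
qed

lemma principal_psd_subset:
  fixes A :: "real^'n::finite^'n"
  assumes "principal_psd C A" "D \<subseteq> C"
  shows "principal_psd D A"
  using assms unfolding principal_psd_def quad_form_superset[OF assms(2)] by auto

lemma quad_form_add_mat:
  fixes A :: "real^'n::finite^'n"
  shows "quad_form C (a *\<^sub>R A + t *\<^sub>R mat 1) x = a * quad_form C A x + t * (\<Sum>i\<in>C. (x i)\<^sup>2)"
proof -
  have "(\<Sum>j\<in>C. x i * (a *\<^sub>R A + t *\<^sub>R mat 1) $ i $ j * x j)
      = a * (\<Sum>j\<in>C. x i * A $ i $ j * x j) + t * (x i)\<^sup>2" if "i \<in> C" for i
  proof -
    have "(\<Sum>j\<in>C. x i * (a *\<^sub>R A + t *\<^sub>R mat 1) $ i $ j * x j)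
        = (\<Sum>j\<in>C. a * (x i * A $ i $ j * x j) + (if j = i then t * (x i)\<^sup>2 else 0))"
      by (rule sum.cong) (auto simp: mat_def algebra_simps power2_eq_square)
    then show ?thesis using that by (simp add: sum.distrib sum_distrib_left)
  qed
  then show ?thesis by (simp add: sum.distrib sum_distrib_left)
qed

lemma sum_squares_pos:
  fixes v :: "'n::finite \<Rightarrow> real"
  assumes "i \<in> C" "v i \<noteq> 0"
  shows "(\<Sum>i\<in>C. (v i)\<^sup>2) > 0"
  using assms by (intro sum_pos2[of C i]) auto

text \<open>If entry \<open>k\<close> of the product were some nonzero \<open>b\<close>, moving
  \<open>v\<close> by \<open>s\<close> in coordinate \<open>k\<close> would give the form the value
  \<open>2 * s * b + s\<^sup>2 * A $ k $ k\<close>, which is negative for small \<open>s\<close> of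
  sign opposite to \<open>b\<close>.\<close>

lemma principal_psd_kernel:
  fixes A :: "real^'n::finite^'n"
  assumes psd: "principal_psd C A" and "quad_form C A v = 0" and k: "k \<in> C"
  shows "(\<Sum>j\<in>C. A $ k $ j * v j) = 0"
proof (rule ccontr)
  define b where "b = (\<Sum>j\<in>C. A $ k $ j * v j)"
  assume "(\<Sum>j\<in>C. A $ k $ j * v j) \<noteq> 0"
  then have b: "b\<^sup>2 > 0" by (simp add: b_def)
  have expand: "quad_form C A (\<lambda>i. v i + (if i = k then s else 0)) = 2 * s * b + s\<^sup>2 * A $ k $ k" for s
  proof -
    have inner: "(\<Sum>j\<in>C. A $ i $ j * (v j + (if j = k then s else 0)))
        = (\<Sum>j\<in>C. A $ i $ j * v j) + s * A $ i $ k" for i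
    proof -
      have "(\<Sum>j\<in>C. A $ i $ j * (v j + (if j = k then s else 0)))
          = (\<Sum>j\<in>C. A $ i $ j * v j + (if j = k then s * A $ i $ k else 0))"
        by (rule sum.cong) (auto simp: algebra_simps)
      then show ?thesis using k by (simp add: sum.distrib)
    qed
    have "quad_form C A (\<lambda>i. v i + (if i = k then s else 0))
      = (\<Sum>i\<in>C. v i * (\<Sum>j\<in>C. A $ i $ j * v j) + s * (v i * A $ i $ k)
           + (if i = k then s * (b + s * A $ k $ k) else 0))"
      unfolding quad_form_alt inner by (rule sum.cong) (auto simp: algebra_simps b_def)
    also have "\<dots> = quad_form C A v + s * (\<Sum>i\<in>C. v i * A $ i $ k) + s * (b + s * A $ k $ k)"
      using k by (simp add: sum.distrib quad_form_alt sum_distrib_left)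
    also have "(\<Sum>i\<in>C. v i * A $ i $ k) = b"
      unfolding b_def by (rule sum.cong) (auto simp: principal_psdD(1)[OF psd _ k])
    finally show ?thesis using assms(2) by (simp add: algebra_simps power2_eq_square)
  qed
  \<comment> \<open>A positive upper bound for the diagonal entry; \<open>s = - b / c\<close> then
    bounds the form by \<open>- (b\<^sup>2 / c)\<close>.\<close>
  define c where "c = \<bar>A $ k $ k\<bar> + 1"
  have c: "c > 0" "A $ k $ k \<le> c" by (auto simp: c_def)
  have "2 * (- b / c) * b + (- b / c)\<^sup>2 * A $ k $ k \<le> 2 * (- b / c) * b + (- b / c)\<^sup>2 * c"
    by (intro add_left_mono mult_left_mono) (use c in auto)
  also have "\<dots> = - (b\<^sup>2 / c)" using c(1) by (simp add: power2_eq_square field_simps)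
  also have "\<dots> < 0" using b c(1) by simp
  finally have "quad_form C A (\<lambda>i. v i + (if i = k then - b / c else 0)) < 0" by (simp add: expand)
  then show False using principal_psdD(2)[OF psd, of "\<lambda>i. v i + (if i = k then - b / c else 0)"] by linarith
qed

text \<open>The minimum \<open>l\<close> of the form on the unit sphere is the least eigenvalue:
  after subtracting \<open>l\<close> from the diagonal the block is semidefinite and its form
  vanishes at the minimizer, which therefore lies in the kernel.\<close>

lemma principal_not_psd_eigenvalue:
  fixes A :: "real^'n::finite^'n"
  assumes sym: "\<And>i j. i \<in> C \<Longrightarrow> j \<in> C \<Longrightarrow> A $ i $ j = A $ j $ i" and "\<not> principal_psd C A"
  obtains l where "l < 0" "leibniz_det C (\<lambda>i j. A $ i $ j - (if i = j then l else 0)) = 0"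
proof -
  obtain x0 where x0: "quad_form C A x0 < 0" using assms by (auto simp: principal_psd_def not_le)
  let ?n = "\<lambda>x. \<Sum>i\<in>C. (x i)\<^sup>2 :: real"
  \<comment> \<open>Vectors indexed by \<open>C\<close> are realised as vectors of the full space
    vanishing off \<open>C\<close>, so that compactness of the sphere applies.\<close>
  define S where "S = sphere 0 1 \<inter> {x :: real^'n. \<forall>i. i \<notin> C \<longrightarrow> x $ i = 0}"
  have "closed {x :: real^'n. \<forall>i. i \<notin> C \<longrightarrow> x $ i = 0}"
    by (intro closed_Collect_all closed_Collect_imp closed_Collect_eq open_Collect_const continuous_intros)
  then have "compact S" unfolding S_def by (intro compact_Int_closed compact_sphere)
  have nrm: "(norm x)\<^sup>2 = ?n (($) x)" if "\<forall>i. i \<notin> C \<longrightarrow> x $ i = 0" for x :: "real^'n"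
  proof -
    have "(norm x)\<^sup>2 = (\<Sum>i\<in>UNIV. (x $ i)\<^sup>2)"
      by (simp add: norm_vec_def L2_set_def sum_nonneg)
    also have "\<dots> = ?n (($) x)" by (rule sum.mono_neutral_right) (use that in auto)
    finally show ?thesis .
  qed
  have scale: "\<exists>z\<in>S. quad_form C A y = ?n y * quad_form C A (($) z)" if "?n y > 0" for y
  proof -
    define r where "r = sqrt (?n y)"
    have r: "r > 0" "r\<^sup>2 = ?n y" using that by (auto simp: r_def)
    define z where "z = (\<chi> i. if i \<in> C then y i / r else 0)"
    have "(norm z)\<^sup>2 = ?n (\<lambda>i. y i / r)" by (subst nrm) (auto simp: z_def)
    also have "\<dots> = ?n y / r\<^sup>2" by (simp add: power_divide sum_divide_distrib)
    finally have "(norm z)\<^sup>2 = 1" using r that by simp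
    then have "norm z = 1" by (simp add: power2_eq_1_iff) (use norm_ge_zero[of z] in linarith)
    then have "z \<in> S" by (auto simp: S_def z_def)
    moreover have "quad_form C A y = r\<^sup>2 * quad_form C A (($) z)"
      unfolding sum_distrib_left z_def using r(1) by (intro sum.cong) (auto simp: power2_eq_square)
    ultimately show ?thesis using r by auto
  qed
  have "?n x0 \<noteq> 0"
  proof
    assume "?n x0 = 0"
    then have "\<forall>i\<in>C. x0 i = 0" by (simp add: sum_nonneg_eq_0_iff)
    then show False using x0 by simp
  qed
  then have n0: "?n x0 > 0" using sum_nonneg[of C "\<lambda>i. (x0 i)\<^sup>2"] by fastforce
  then have "S \<noteq> {}" using scale by blast
  have "continuous_on S (\<lambda>x. quad_form C A (($) x))" by (intro continuous_intros)
  then obtain v where v: "v \<in> S" "\<And>z. z \<in> S \<Longrightarrow> quad_form C A (($) v) \<le> quad_form C A (($) z)"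
    using continuous_attains_inf[OF \<open>compact S\<close> \<open>S \<noteq> {}\<close>] by blast
  define l where "l = quad_form C A (($) v)"
  have nv: "?n (($) v) = 1" using nrm[of v] v(1) by (auto simp: S_def)
  have ge: "quad_form C A y \<ge> l * ?n y" for y
  proof (cases "?n y > 0")
    case True
    obtain z where "z \<in> S" "quad_form C A y = ?n y * quad_form C A (($) z)" using scale[OF True] by blast
    then show ?thesis using v(2)[of z] True by (simp add: l_def mult.commute)
  next
    case False
    then have "?n y = 0" using sum_nonneg[of C "\<lambda>i. (y i)\<^sup>2"] by fastforce
    moreover from this have "\<forall>i\<in>C. y i = 0" by (simp add: sum_nonneg_eq_0_iff)
    ultimately show ?thesis by simp
  qed
  have l: "l < 0"
  proof (rule ccontr)
    assume "\<not> l < 0"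
    then have "l * ?n x0 \<ge> 0" using n0 by simp
    then show False using ge[of x0] x0 by linarith
  qed
  define B where "B = 1 *\<^sub>R A + (- l) *\<^sub>R mat 1"
  have qB: "quad_form C B y = quad_form C A y - l * ?n y" for y
    unfolding B_def quad_form_add_mat by simp
  have Bij: "B $ i $ j = A $ i $ j - (if i = j then l else 0)" for i j
    by (simp add: B_def mat_def)
  have "principal_psd C B"
  proof (rule principal_psdI)
    show "quad_form C B x \<ge> 0" for x using ge[of x] unfolding qB by simp
  qed (simp add: Bij sym)
  moreover have "quad_form C B (($) v) = 0" using nv by (simp only: qB) (simp add: l_def)
  ultimately have "\<forall>i\<in>C. (\<Sum>j\<in>C. B $ i $ j * v $ j) = 0" using principal_psd_kernel by blast
  moreover have "\<exists>i\<in>C. v $ i \<noteq> 0"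
  proof (rule ccontr)
    assume "\<not> (\<exists>i\<in>C. v $ i \<noteq> 0)"
    then show False using nv by simp
  qed
  ultimately have "leibniz_det C (\<lambda>i j. B $ i $ j) = 0" by (auto simp: leibniz_det_eq_0_iff)
  then show ?thesis using that[OF l] by (simp add: Bij)
qed

lemma principal_det_kernel:
  fixes A :: "real^'n::finite^'n"
  assumes "principal_det C A = 0"
  obtains v k where "k \<in> C" "v k \<noteq> 0" "\<And>i. i \<in> C \<Longrightarrow> (\<Sum>j\<in>C. A $ i $ j * v j) = 0"
  using assms by (auto simp: principal_det_leibniz leibniz_det_eq_0_iff)

lemma principal_det_nz:
  fixes A :: "real^'n::finite^'n"
  assumes "\<And>x k. k \<in> C \<Longrightarrow> x k \<noteq> 0 \<Longrightarrow> quad_form C A x > 0"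
  shows "principal_det C A \<noteq> 0"
proof
  assume "principal_det C A = 0"
  then obtain v k where v: "k \<in> C" "v k \<noteq> 0" "\<And>i. i \<in> C \<Longrightarrow> (\<Sum>j\<in>C. A $ i $ j * v j) = 0"
    by (rule principal_det_kernel) blast
  then have "quad_form C A v = 0" unfolding quad_form_alt by simp
  then show False using assms[of k v] v by simp
qed

section \<open>Principal minors and semidefiniteness\<close>

lemma continuous_on_principal_det [continuous_intros]:
  assumes "continuous_on S f"
  shows "continuous_on S (\<lambda>x. principal_det C (f x :: real^'n::finite^'n))"
  unfolding principal_det_def by (intro continuous_intros assms)

lemma principal_det_mat_1: "principal_det C (mat 1 :: real^'n::finite^'n) = 1"
proof -
  have "principal_det C (mat 1 :: real^'n^'n) =
      det (\<chi> i j. if i \<in> C \<and> j \<in> C then (mat 1 :: real^'n^'n) $ i $ j else if i = j then 1 else 0)"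
    by (simp add: principal_det_leibniz det_embed_block)
  also have "\<dots> = det (mat 1 :: real^'n^'n)"
    by (rule arg_cong[where f = det]) (auto simp: mat_def vec_eq_iff)
  finally show ?thesis by simp
qed

text \<open>On the segment from \<open>A\<close> to the identity every later point is positive
  definite, hence nonsingular, whereas a negative determinant at \<open>A\<close> would have to
  cross 0 on its way to 1.\<close>

lemma principal_psd_det_nonneg:
  fixes A :: "real^'n::finite^'n"
  assumes psd: "principal_psd C A"
  shows "principal_det C A \<ge> 0"
proof (rule ccontr)
  assume neg: "\<not> principal_det C A \<ge> 0"
  define f where "f = (\<lambda>s. principal_det C ((1 - s) *\<^sub>R A + s *\<^sub>R mat 1))"
  have "continuous_on {0..1} f" unfolding f_def by (intro continuous_intros)
  moreover have "f 0 < 0" "f 1 = 1" using neg by (simp_all add: f_def principal_det_mat_1)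
  ultimately obtain s where s: "0 \<le> s" "s \<le> 1" "f s = 0"
    using IVT'[of f 0 0 1] by auto
  then have "s > 0" using \<open>f 0 < 0\<close> by (cases "s = 0") auto
  have "f s \<noteq> 0" unfolding f_def
  proof (rule principal_det_nz)
    fix x :: "'n \<Rightarrow> real" and k assume "k \<in> C" "x k \<noteq> 0"
    then have "s * (\<Sum>i\<in>C. (x i)\<^sup>2) > 0" using sum_squares_pos[of k C x] \<open>s > 0\<close> by simp
    moreover have "(1 - s) * quad_form C A x \<ge> 0" using s principal_psdD(2)[OF psd] by simp
    ultimately show "quad_form C ((1 - s) *\<^sub>R A + s *\<^sub>R mat 1) x > 0"
      by (simp only: quad_form_add_mat)
  qed
  then show False using s by simp
qed

lemma principal_pd_det_pos:
  fixes A :: "real^'n::finite^'n"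
  assumes "\<And>i j. i \<in> C \<Longrightarrow> j \<in> C \<Longrightarrow> A $ i $ j = A $ j $ i"
    and pos: "\<And>x k. k \<in> C \<Longrightarrow> x k \<noteq> 0 \<Longrightarrow> quad_form C A x > 0"
  shows "principal_det C A > 0"
proof -
  have "quad_form C A x \<ge> 0" for x
    by (cases "\<exists>k\<in>C. x k \<noteq> 0") (use pos[of _ x] in \<open>auto simp: less_imp_le\<close>)
  then have "principal_det C A \<ge> 0"
    by (intro principal_psd_det_nonneg principal_psdI assms(1)) auto
  then show ?thesis using principal_det_nz[of C A] pos by (simp add: less_le)
qed

text \<open>Diagonal entries are raised one at a time. Raising entry \<open>k\<close> adds to a
  minor containing \<open>k\<close> the multiple \<open>t\<close> of the minor without
  \<open>k\<close>. So minors stay nonnegative, and those inside \<open>S\<close> become positive,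
  starting from the empty minor 1.\<close>

lemma leibniz_det_add_pos_diagonal:
  fixes A :: "'n::finite \<Rightarrow> 'n \<Rightarrow> real"
  assumes minors: "\<And>D. D \<subseteq> C \<Longrightarrow> leibniz_det D A \<ge> 0" and "t > 0" and "S \<subseteq> C"
  shows "(\<forall>D\<subseteq>C. leibniz_det D (\<lambda>i j. A i j + (if i = j \<and> i \<in> S then t else 0)) \<ge> 0) \<and>
    (\<forall>D\<subseteq>S. leibniz_det D (\<lambda>i j. A i j + (if i = j \<and> i \<in> S then t else 0)) > 0)"
  using finite[of S] \<open>S \<subseteq> C\<close>
proof (induction S rule: finite_induct)
  case empty
  then show ?case using minors by (simp add: leibniz_det_def)
next
  case (insert k S)
  define B where "B = (\<lambda>i j. A i j + (if i = j \<and> i \<in> S then t else 0))"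
  define B' where "B' = (\<lambda>i j. A i j + (if i = j \<and> i \<in> insert k S then t else 0))"
  have IH: "D \<subseteq> C \<Longrightarrow> leibniz_det D B \<ge> 0" "D \<subseteq> S \<Longrightarrow> leibniz_det D B > 0" for D
    using insert by (auto simp: B_def)
  have same: "leibniz_det D B' = leibniz_det D B" if "k \<notin> D" for D
    by (rule leibniz_det_cong) (use that in \<open>auto simp: B_def B'_def\<close>)
  have more: "leibniz_det D B' = leibniz_det D B + t * leibniz_det (D - {k}) B" if "k \<in> D" for D
  proof -
    have "B' = (\<lambda>i j. B i j + (if i = k \<and> j = k then t else 0))"
      using insert(2) by (auto simp: B_def B'_def fun_eq_iff)
    then show ?thesis using leibniz_det_add_diagonal[OF that, of B t] by simp
  qed
  have "leibniz_det D B' \<ge> 0" if "D \<subseteq> C" for D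
  proof (cases "k \<in> D")
    case True
    have "leibniz_det (D - {k}) B \<ge> 0" using that by (intro IH) auto
    then show ?thesis using IH(1)[OF that] \<open>t > 0\<close> by (simp add: more[OF True])
  qed (use IH(1)[OF that] in \<open>simp add: same\<close>)
  moreover have "leibniz_det D B' > 0" if "D \<subseteq> insert k S" for D
  proof (cases "k \<in> D")
    case True
    have "leibniz_det (D - {k}) B > 0" using that by (intro IH) auto
    moreover have "leibniz_det D B \<ge> 0" using that insert by (intro IH) auto
    ultimately show ?thesis using \<open>t > 0\<close> by (simp add: more[OF True] add_nonneg_pos)
  next
    case False
    then have "D \<subseteq> S" using that by auto
    then show ?thesis using IH(2) False by (simp add: same)
  qed
  ultimately show ?case by (simp add: B'_def)
qed

text \<open>Given nonnegative minors, a negative eigenvalue \<open>l\<close> is impossible: adding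
  \<open>- l\<close> to the diagonal would make the determinant positive, not 0. The criterion turns
  membership in the cone into polynomial inequalities, which yields closedness and
  semialgebraicity.\<close>

lemma principal_psd_iff_minors:
  fixes A :: "real^'n::finite^'n"
  assumes sym: "\<And>i j. i \<in> C \<Longrightarrow> j \<in> C \<Longrightarrow> A $ i $ j = A $ j $ i"
  shows "principal_psd C A \<longleftrightarrow> (\<forall>D\<subseteq>C. principal_det D A \<ge> 0)"
proof
  assume "principal_psd C A"
  then show "\<forall>D\<subseteq>C. principal_det D A \<ge> 0"
    using principal_psd_det_nonneg principal_psd_subset by blast
next
  assume minors: "\<forall>D\<subseteq>C. principal_det D A \<ge> 0"
  show "principal_psd C A"
  proof (rule ccontr)
    assume "\<not> principal_psd C A"
    then obtain l where l: "l < 0" "leibniz_det C (\<lambda>i j. A $ i $ j - (if i = j then l else 0)) = 0"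
      using principal_not_psd_eigenvalue[OF sym] by blast
    have "leibniz_det C (\<lambda>i j. A $ i $ j + (if i = j \<and> i \<in> C then - l else 0)) > 0"
      using leibniz_det_add_pos_diagonal[of C "\<lambda>i j. A $ i $ j" "- l" C] minors l(1)
      by (auto simp: principal_det_leibniz)
    also have "leibniz_det C (\<lambda>i j. A $ i $ j + (if i = j \<and> i \<in> C then - l else 0))
      = leibniz_det C (\<lambda>i j. A $ i $ j - (if i = j then l else 0))"
      by (rule leibniz_det_cong) auto
    finally show False using l by simp
  qed
qed

lemma principal_pd_if_psd_det_nz:
  fixes A :: "real^'n::finite^'n"
  assumes "principal_psd C A" "principal_det C A \<noteq> 0" "k \<in> C" "x k \<noteq> 0"
  shows "quad_form C A x > 0"
proof (rule ccontr)
  assume "\<not> quad_form C A x > 0"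
  then have "quad_form C A x = 0" using principal_psdD(2)[OF assms(1), of x] by linarith
  then have "\<forall>i\<in>C. (\<Sum>j\<in>C. A $ i $ j * x j) = 0" using principal_psd_kernel[OF assms(1)] by blast
  then show False
    using assms by (auto simp: principal_det_leibniz leibniz_det_eq_0_iff)
qed

lemma principal_minor_pos:
  fixes A :: "real^'n::finite^'n"
  assumes psd: "principal_psd C A" and nz: "principal_det C A \<noteq> 0" and "D \<subseteq> C"
  shows "principal_det D A > 0"
proof (rule principal_pd_det_pos)
  show "A $ i $ j = A $ j $ i" if "i \<in> D" "j \<in> D" for i j
    using that assms principal_psdD(1) by blast
  show "quad_form D A x > 0" if "k \<in> D" "x k \<noteq> 0" for x k
    unfolding quad_form_superset[OF \<open>D \<subseteq> C\<close>]
    by (rule principal_pd_if_psd_det_nz[OF psd nz, of k]) (use that assms in auto)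
qed

section \<open>Polynomials on a subspace\<close>

lemma homogeneous_on_monomial:
  fixes \<alpha> :: "'a::euclidean_space \<Rightarrow> nat"
  assumes "sum \<alpha> Basis = d"
  shows "homogeneous_on V d (\<lambda>x. \<Prod>b\<in>Basis. (x \<bullet> b) ^ \<alpha> b)"
proof -
  let ?I = "{\<beta>. \<beta> \<in> Basis \<rightarrow>\<^sub>E {..d} \<and> sum \<beta> Basis = d}"
  \<comment> \<open>The definition sums over extensional functions on \<open>Basis\<close>, so the
    multi-index must be restricted before its coefficient can be singled out.\<close>
  let ?r = "restrict \<alpha> Basis"
  have fin: "finite ?I" by (rule finite_subset[of _ "Basis \<rightarrow>\<^sub>E {..d}"]) (auto intro: finite_PiE)
  have r: "?r \<in> ?I" using assms by (auto intro: member_le_sum)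
  have "(\<Sum>\<beta>\<in>?I. (if \<beta> = ?r then 1 else 0) * (\<Prod>b\<in>Basis. (x \<bullet> b) ^ \<beta> b))
      = (\<Prod>b\<in>Basis. (x \<bullet> b) ^ \<alpha> b)" for x :: 'a
  proof -
    have "(\<Sum>\<beta>\<in>?I. (if \<beta> = ?r then 1 else 0) * (\<Prod>b\<in>Basis. (x \<bullet> b) ^ \<beta> b))
        = (\<Sum>\<beta>\<in>?I. if \<beta> = ?r then \<Prod>b\<in>Basis. (x \<bullet> b) ^ \<beta> b else 0)"
      by (rule sum.cong) auto
    also have "\<dots> = (if ?r \<in> ?I then \<Prod>b\<in>Basis. (x \<bullet> b) ^ ?r b else 0)"
      by (rule sum.delta[OF fin])
    also have "\<dots> = (\<Prod>b\<in>Basis. (x \<bullet> b) ^ ?r b)" by (simp only: r if_True)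
    finally show ?thesis by simp
  qed
  then show ?thesis
    unfolding homogeneous_on_def
    by (intro exI[of _ "\<lambda>\<beta>. if \<beta> = ?r then 1 else 0"]) simp
qed

lemma homogeneous_on_add:
  assumes "homogeneous_on V d f" "homogeneous_on V d g"
  shows "homogeneous_on V d (\<lambda>x. f x + g x)"
proof -
  obtain a b where "\<forall>x\<in>V. f x = (\<Sum>\<alpha> | \<alpha> \<in> Basis \<rightarrow>\<^sub>E {..d} \<and> sum \<alpha> Basis = d. a \<alpha> * (\<Prod>b\<in>Basis. (x \<bullet> b) ^ \<alpha> b))"
    "\<forall>x\<in>V. g x = (\<Sum>\<alpha> | \<alpha> \<in> Basis \<rightarrow>\<^sub>E {..d} \<and> sum \<alpha> Basis = d. b \<alpha> * (\<Prod>b\<in>Basis. (x \<bullet> b) ^ \<alpha> b))"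
    using assms unfolding homogeneous_on_def by blast
  then show ?thesis
    unfolding homogeneous_on_def
    by (intro exI[of _ "\<lambda>\<alpha>. a \<alpha> + b \<alpha>"]) (simp add: distrib_right sum.distrib)
qed

lemma homogeneous_on_cmult:
  assumes "homogeneous_on V d f"
  shows "homogeneous_on V d (\<lambda>x. c * f x)"
proof -
  obtain a where "\<forall>x\<in>V. f x = (\<Sum>\<alpha> | \<alpha> \<in> Basis \<rightarrow>\<^sub>E {..d} \<and> sum \<alpha> Basis = d. a \<alpha> * (\<Prod>b\<in>Basis. (x \<bullet> b) ^ \<alpha> b))"
    using assms unfolding homogeneous_on_def by blast
  then show ?thesis
    unfolding homogeneous_on_def
    by (intro exI[of _ "\<lambda>\<alpha>. c * a \<alpha>"]) (simp add: sum_distrib_left mult.assoc)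
qed

lemma homogeneous_on_sum:
  assumes "\<And>i. i \<in> I \<Longrightarrow> homogeneous_on V d (f i)"
  shows "homogeneous_on V d (\<lambda>x. \<Sum>i\<in>I. f i x)"
proof -
  have "homogeneous_on V d (\<lambda>x. 0)"
    unfolding homogeneous_on_def by (intro exI[of _ "\<lambda>_. 0"]) simp
  with assms show ?thesis
    by (induction I rule: infinite_finite_induct) (auto intro: homogeneous_on_add)
qed

lemma homogeneous_on_eq:
  assumes "homogeneous_on V d f" "\<And>x. x \<in> V \<Longrightarrow> f x = g x"
  shows "homogeneous_on V d g"
  using assms unfolding homogeneous_on_def by simp

lemma homogeneous_on_mult:
  assumes "homogeneous_on V d f" "homogeneous_on V e g"
  shows "homogeneous_on V (d + e) (\<lambda>x. f x * g x)"
proof -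
  let ?I = "\<lambda>d. {\<alpha>. \<alpha> \<in> Basis \<rightarrow>\<^sub>E {..d} \<and> sum \<alpha> Basis = d} :: ('a \<Rightarrow> nat) set"
  obtain a b where ab: "\<forall>x\<in>V. f x = (\<Sum>\<alpha>\<in>?I d. a \<alpha> * (\<Prod>b\<in>Basis. (x \<bullet> b) ^ \<alpha> b))"
    "\<forall>x\<in>V. g x = (\<Sum>\<alpha>\<in>?I e. b \<alpha> * (\<Prod>b\<in>Basis. (x \<bullet> b) ^ \<alpha> b))"
    using assms unfolding homogeneous_on_def by blast
  have "homogeneous_on V (d + e) (\<lambda>x. \<Sum>\<alpha>\<in>?I d. \<Sum>\<beta>\<in>?I e. (a \<alpha> * b \<beta>) * (\<Prod>b\<in>Basis. (x \<bullet> b) ^ (\<alpha> b + \<beta> b)))"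
    by (intro homogeneous_on_sum homogeneous_on_cmult homogeneous_on_monomial)
       (auto simp: sum.distrib)
  then show ?thesis
    by (rule homogeneous_on_eq) (simp add: ab sum_product power_add prod.distrib mult_ac)
qed

lemma homogeneous_on_const: "homogeneous_on V 0 (\<lambda>x. c)"
  using homogeneous_on_cmult[OF homogeneous_on_monomial[of "\<lambda>_. 0" 0 V], of c] by simp

lemma homogeneous_on_prod:
  assumes "finite I" "\<And>i. i \<in> I \<Longrightarrow> homogeneous_on V (d i) (f i)"
  shows "homogeneous_on V (\<Sum>i\<in>I. d i) (\<lambda>x. \<Prod>i\<in>I. f i x)"
  using assms by (induction I rule: finite_induct) (auto intro: homogeneous_on_mult homogeneous_on_const)

lemma homogeneous_on_inner_Basis:
  assumes "b \<in> Basis"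
  shows "homogeneous_on V 1 (\<lambda>x. x \<bullet> b)"
proof -
  have "homogeneous_on V 1 (\<lambda>x. \<Prod>c\<in>Basis. (x \<bullet> c) ^ (if c = b then 1 else 0))"
    by (rule homogeneous_on_monomial) (use assms in simp)
  then show ?thesis
    by (rule homogeneous_on_eq) (use assms in \<open>simp add: if_distrib[of "\<lambda>n. _ ^ n"] cong: if_cong\<close>)
qed

lemma homogeneous_on_matrix_entry: "homogeneous_on V 1 (\<lambda>X :: real^'n::finite^'n. X $ i $ j)"
proof -
  have "axis i (axis j 1) \<in> (Basis :: (real^'n^'n) set)" by (auto simp: Basis_vec_def)
  from homogeneous_on_inner_Basis[OF this, of V] show ?thesis by (simp add: inner_axis)
qed

lemma homogeneous_on_principal_det:
  "homogeneous_on V (card C) (principal_det C :: real^'n::finite^'n \<Rightarrow> real)"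
proof -
  have "homogeneous_on V (\<Sum>i\<in>C. 1) (\<lambda>X :: real^'n^'n. \<Sum>\<pi> | \<pi> permutes C. of_int (sign \<pi>) * (\<Prod>i\<in>C. X $ i $ \<pi> i))"
    by (intro homogeneous_on_sum homogeneous_on_cmult homogeneous_on_prod homogeneous_on_matrix_entry) simp
  then show ?thesis unfolding principal_det_def[abs_def] by simp
qed

lemma homogeneous_on_clique_poly:
  fixes E :: "'n::finite set set"
  shows "homogeneous_on V (\<Sum>C\<in>maximal_cliques E. card C) (clique_poly E)"
  unfolding clique_poly_def[abs_def]
  by (intro homogeneous_on_prod homogeneous_on_principal_det) simp

lemma homogeneous_on_imp_polynomial_le_on:
  fixes V :: "'a::euclidean_space set"
  assumes "homogeneous_on V d f"
  shows "polynomial_le_on V d f"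
proof -
  let ?I = "{\<alpha>. \<alpha> \<in> Basis \<rightarrow>\<^sub>E {..d} \<and> sum \<alpha> Basis = d} :: ('a \<Rightarrow> nat) set"
  let ?J = "{\<alpha>. \<alpha> \<in> Basis \<rightarrow>\<^sub>E {..d} \<and> sum \<alpha> Basis \<le> d} :: ('a \<Rightarrow> nat) set"
  obtain a where a: "\<forall>x\<in>V. f x = (\<Sum>\<alpha>\<in>?I. a \<alpha> * (\<Prod>b\<in>Basis. (x \<bullet> b) ^ \<alpha> b))"
    using assms unfolding homogeneous_on_def by blast
  have "finite ?J" by (rule finite_subset[of _ "Basis \<rightarrow>\<^sub>E {..d}"]) (auto intro: finite_PiE)
  then have "(\<Sum>\<alpha>\<in>?J. (if sum \<alpha> Basis = d then a \<alpha> else 0) * (\<Prod>b\<in>Basis. (x \<bullet> b) ^ \<alpha> b))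
      = (\<Sum>\<alpha>\<in>?I. a \<alpha> * (\<Prod>b\<in>Basis. (x \<bullet> b) ^ \<alpha> b))" for x :: 'a
    by (intro sum.mono_neutral_cong_right) auto
  with a show ?thesis
    unfolding polynomial_le_on_def
    by (intro exI[of _ "\<lambda>\<alpha>. if sum \<alpha> Basis = d then a \<alpha> else 0"]) simp
qed

lemma polynomial_on_if_homogeneous: "homogeneous_on V d f \<Longrightarrow> polynomial_on V f"
  unfolding polynomial_on_def using homogeneous_on_imp_polynomial_le_on by blast

text \<open>Both the density argument and the zero count reduce to one variable here.
  \<open>u\<close> lives on the whole line, but \<open>q\<close> is known to be polynomial only at
  the points of \<open>V\<close>.\<close>

lemma polynomial_le_on_line:
  fixes x y :: "'a::euclidean_space"
  assumes "polynomial_le_on V m q"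
  obtains u where "degree u \<le> m" "\<And>t. x + t *\<^sub>R y \<in> V \<Longrightarrow> q (x + t *\<^sub>R y) = poly u t"
proof -
  let ?J = "{\<alpha>. \<alpha> \<in> Basis \<rightarrow>\<^sub>E {..m} \<and> sum \<alpha> Basis \<le> m} :: ('a \<Rightarrow> nat) set"
  obtain a where a: "\<forall>x\<in>V. q x = (\<Sum>\<alpha>\<in>?J. a \<alpha> * (\<Prod>b\<in>Basis. (x \<bullet> b) ^ \<alpha> b))"
    using assms unfolding polynomial_le_on_def by blast
  define u where "u = (\<Sum>\<alpha>\<in>?J. smult (a \<alpha>) (\<Prod>b\<in>Basis. [:x \<bullet> b, y \<bullet> b:] ^ \<alpha> b))"
  have "degree u \<le> m" unfolding u_def
  proof (rule degree_sum_le)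
    show "finite ?J" by (rule finite_subset[of _ "Basis \<rightarrow>\<^sub>E {..m}"]) (auto intro: finite_PiE)
    fix \<alpha> assume \<alpha>: "\<alpha> \<in> ?J"
    have "degree (\<Prod>b\<in>Basis. [:x \<bullet> b, y \<bullet> b:] ^ \<alpha> b) \<le> (\<Sum>b\<in>Basis. degree ([:x \<bullet> b, y \<bullet> b:] ^ \<alpha> b))"
      using degree_prod_sum_le[of Basis "\<lambda>b. [:x \<bullet> b, y \<bullet> b:] ^ \<alpha> b"] by (simp add: o_def)
    also have "\<dots> \<le> (\<Sum>b\<in>Basis. \<alpha> b)"
    proof (rule sum_mono)
      fix b
      have "degree ([:x \<bullet> b, y \<bullet> b:] ^ \<alpha> b) \<le> degree [:x \<bullet> b, y \<bullet> b:] * \<alpha> b" by (rule degree_power_le)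
      also have "\<dots> \<le> 1 * \<alpha> b" by (rule mult_right_mono) auto
      finally show "degree ([:x \<bullet> b, y \<bullet> b:] ^ \<alpha> b) \<le> \<alpha> b" by simp
    qed
    finally show "degree (smult (a \<alpha>) (\<Prod>b\<in>Basis. [:x \<bullet> b, y \<bullet> b:] ^ \<alpha> b)) \<le> m"
      using \<alpha> degree_smult_le[of "a \<alpha>" "\<Prod>b\<in>Basis. [:x \<bullet> b, y \<bullet> b:] ^ \<alpha> b"] by simp
  qed
  moreover have "q (x + t *\<^sub>R y) = poly u t" if "x + t *\<^sub>R y \<in> V" for t
    using a that by (simp add: u_def poly_sum poly_prod inner_add_left mult.commute)
  ultimately show ?thesis by (rule that)
qed

lemma polynomial_on_eq_continuous:
  fixes V :: "'a::euclidean_space set"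
  assumes "polynomial_on V q"
  shows "continuous_on V q"
proof -
  obtain m where "polynomial_le_on V m q" using assms polynomial_on_def by blast
  then obtain a where a: "\<And>x. x \<in> V \<Longrightarrow> q x = (\<Sum>\<alpha> | \<alpha> \<in> Basis \<rightarrow>\<^sub>E {..m} \<and> sum \<alpha> Basis \<le> m.
      a \<alpha> * (\<Prod>b\<in>Basis. (x \<bullet> b) ^ \<alpha> b))"
    unfolding polynomial_le_on_def by blast
  have "continuous_on V (\<lambda>x. \<Sum>\<alpha> | \<alpha> \<in> Basis \<rightarrow>\<^sub>E {..m} \<and> sum \<alpha> Basis \<le> m.
      a \<alpha> * (\<Prod>b\<in>Basis. (x \<bullet> b) ^ \<alpha> b))"
    by (intro continuous_intros)
  then show ?thesis using a by (simp cong: continuous_on_cong)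
qed

text \<open>Follow the segment from \<open>x\<close> to \<open>y\<close>, on which the polynomial has finitely many zeros.\<close>

lemma polynomial_nonzero_nearby:
  fixes V :: "'a::euclidean_space set"
  assumes q: "polynomial_on V q" and W: "convex W" "W \<subseteq> V"
    and x: "x \<in> W" and y: "y \<in> W" "q y \<noteq> 0" and U: "open U" "x \<in> U"
  obtains z where "z \<in> W" "z \<in> U" "q z \<noteq> 0"
proof -
  obtain m where "polynomial_le_on V m q" using q polynomial_on_def by blast
  then obtain u where u: "\<And>t. x + t *\<^sub>R (y - x) \<in> V \<Longrightarrow> q (x + t *\<^sub>R (y - x)) = poly u t"
    by (rule polynomial_le_on_line) blast
  have seg: "x + t *\<^sub>R (y - x) \<in> W" if "0 \<le> t" "t \<le> 1" for t
  proof -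
    have "(1 - t) *\<^sub>R x + t *\<^sub>R y \<in> W" using that W x y by (intro convexD) auto
    then show ?thesis by (simp add: algebra_simps)
  qed
  have "q (x + 1 *\<^sub>R (y - x)) = poly u 1" using seg[of 1] W by (intro u) auto
  then have "u \<noteq> 0" using y by auto
  then have fin: "finite {t. poly u t = 0}" by (rule poly_roots_finite)
  have lim: "((\<lambda>t. x + t *\<^sub>R (y - x)) \<longlongrightarrow> x + 0 *\<^sub>R (y - x)) (at_right 0)"
    by (intro tendsto_intros)
  have "\<forall>\<^sub>F t in at_right 0. x + t *\<^sub>R (y - x) \<in> U"
    using topological_tendstoD[OF lim, of U] U by simp
  moreover have "\<forall>\<^sub>F t in at_right (0::real). t \<in> {0<..<1}"
    by (rule eventually_at_right_real) simp
  moreover have "\<forall>\<^sub>F t in at_right (0::real). poly u t \<noteq> 0"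
  proof -
    have "\<not> 0 islimpt {t. poly u t = 0}" using islimpt_finite[OF fin] by blast
    then have "\<forall>\<^sub>F t in at (0::real). poly u t \<noteq> 0"
      by (simp add: islimpt_iff_eventually)
    then show ?thesis by (simp add: eventually_at_split)
  qed
  ultimately have "\<forall>\<^sub>F t in at_right (0::real). x + t *\<^sub>R (y - x) \<in> U \<and> t \<in> {0<..<1} \<and> poly u t \<noteq> 0"
    by (intro eventually_conj)
  then obtain t where t: "x + t *\<^sub>R (y - x) \<in> U" "0 < t" "t < 1" "poly u t \<noteq> 0"
    using eventually_happens[of _ "at_right (0::real)"] by (auto simp: trivial_limit_at_right_real)
  then show ?thesis using that[of "x + t *\<^sub>R (y - x)"] seg[of t] u[of t] W by force
qed

section \<open>Evaluating real polynomials at complex points\<close>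

lemma poly_map_of_real_add:
  "poly (map_poly complex_of_real (p + q)) z
    = poly (map_poly of_real p) z + poly (map_poly of_real q) z"
  by (induction p q rule: poly_induct2) (auto simp: map_poly_pCons algebra_simps)

lemma poly_map_of_real_smult:
  "poly (map_poly complex_of_real (smult c p)) z = of_real c * poly (map_poly of_real p) z"
  by (induction p) (auto simp: map_poly_pCons algebra_simps)

lemma poly_map_of_real_mult:
  "poly (map_poly complex_of_real (p * q)) z
    = poly (map_poly of_real p) z * poly (map_poly of_real q) z"
  by (induction p) (auto simp: map_poly_pCons poly_map_of_real_add poly_map_of_real_smult algebra_simps)

lemma poly_map_of_real_sum:
  "poly (map_poly complex_of_real (\<Sum>i\<in>I. f i)) z = (\<Sum>i\<in>I. poly (map_poly of_real (f i)) z)"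
  by (induction I rule: infinite_finite_induct) (simp_all add: poly_map_of_real_add)

lemma poly_map_of_real_prod:
  "poly (map_poly complex_of_real (\<Prod>i\<in>I. f i)) z = (\<Prod>i\<in>I. poly (map_poly of_real (f i)) z)"
  by (induction I rule: infinite_finite_induct) (simp_all add: poly_map_of_real_mult map_poly_1)

section \<open>The cone of a graph\<close>

lemma subspace_graph_matrices: "subspace (graph_matrices E :: (real^'n::finite^'n) set)"
  by (auto simp: subspace_def graph_matrices_def transpose_def vec_eq_iff)

lemma graph_matrices_sym: "X \<in> graph_matrices E \<Longrightarrow> X $ i $ j = X $ j $ i"
  unfolding graph_matrices_def transpose_def vec_eq_iff by simp

lemma mat_1_in_graph_matrices: "mat 1 \<in> graph_matrices E"
  unfolding graph_matrices_def mem_Collect_eq transpose_mat by (simp add: mat_def)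

lemma clique_subset: "clique E C \<Longrightarrow> D \<subseteq> C \<Longrightarrow> clique E D"
  by (auto simp: clique_def)

lemma clique_singleton: "clique E {i}"
  by (auto simp: clique_def)

lemma maximal_cliquesD:
  assumes "C \<in> maximal_cliques E"
  shows "clique E C" "\<And>D. clique E D \<Longrightarrow> C \<subseteq> D \<Longrightarrow> D = C"
  using assms by (auto simp: maximal_cliques_def)

lemma clique_in_maximal_clique:
  fixes E :: "'n::finite set set"
  assumes "clique E D"
  obtains C where "C \<in> maximal_cliques E" "D \<subseteq> C"
proof -
  obtain C where "C \<in> {C. clique E C}" "D \<subseteq> C" "\<forall>B\<in>{C. clique E C}. C \<subseteq> B \<longrightarrow> C = B"
    using finite_has_maximal2[of "{C. clique E C}" D] assms by auto
  then show ?thesis by (intro that[of C]) (auto simp: maximal_cliques_def)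
qed

text \<open>Subsets of cliques are cliques, so the minors of all clique blocks amount to one
  inequality per clique.\<close>

lemma clique_psd_cone_iff_minors:
  fixes E :: "'n::finite set set"
  shows "A \<in> clique_psd_cone E \<longleftrightarrow> A \<in> graph_matrices E \<and> (\<forall>D. clique E D \<longrightarrow> principal_det D A \<ge> 0)"
proof (cases "A \<in> graph_matrices E")
  case True
  then have "principal_psd C A \<longleftrightarrow> (\<forall>D\<subseteq>C. principal_det D A \<ge> 0)" for C
    by (intro principal_psd_iff_minors) (rule graph_matrices_sym)
  then have "A \<in> clique_psd_cone E \<longleftrightarrow> (\<forall>C. clique E C \<longrightarrow> (\<forall>D\<subseteq>C. principal_det D A \<ge> 0))"
    using True by (simp add: clique_psd_cone_def)
  also have "\<dots> \<longleftrightarrow> (\<forall>D. clique E D \<longrightarrow> principal_det D A \<ge> 0)"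
    using clique_subset[of E] by (meson order_refl)
  finally show ?thesis using True by simp
qed (simp add: clique_psd_cone_def)

lemma clique_psd_cone_iff_maximal:
  fixes E :: "'n::finite set set"
  shows "A \<in> clique_psd_cone E \<longleftrightarrow>
    A \<in> graph_matrices E \<and> (\<forall>C\<in>maximal_cliques E. principal_psd C A)"
  unfolding clique_psd_cone_def mem_Collect_eq
  by (meson clique_in_maximal_clique maximal_cliquesD(1) principal_psd_subset)

lemma closedin_clique_psd_cone:
  fixes E :: "'n::finite set set"
  shows "closedin (top_of_set (graph_matrices E)) (clique_psd_cone E)"
proof -
  have "clique_psd_cone E = graph_matrices E \<inter> {A. \<forall>D. clique E D \<longrightarrow> principal_det D A \<ge> 0}"
    using clique_psd_cone_iff_minors by blast
  moreover have "closed {A :: real^'n^'n. \<forall>D. clique E D \<longrightarrow> principal_det D A \<ge> 0}"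
    by (intro closed_Collect_all closed_Collect_imp open_Collect_const closed_Collect_le continuous_intros)
  ultimately show ?thesis by (auto intro: closedin_closed_Int)
qed

section \<open>Semialgebraicity of the cone\<close>

lemma semialgebraic_in_Int:
  assumes "semialgebraic_in V A" "semialgebraic_in V B" "A \<subseteq> V" "B \<subseteq> V"
  shows "semialgebraic_in V (A \<inter> B)"
proof -
  have "V - ((V - A) \<union> (V - B)) = A \<inter> B" using assms(3,4) by blast
  then show ?thesis
    using semialgebraic_in.compl[OF semialgebraic_in.union[OF assms(1,2)[THEN semialgebraic_in.compl]]]
    by simp
qed

lemma semialgebraic_in_nonneg:
  assumes "homogeneous_on V d f"
  shows "semialgebraic_in V {x \<in> V. f x \<ge> 0}"
proof -
  have "homogeneous_on V d (\<lambda>x. - f x)" using homogeneous_on_cmult[OF assms, of "-1"] by simp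
  then have "semialgebraic_in V (V - {x \<in> V. - f x > 0})"
    by (intro semialgebraic_in.compl semialgebraic_in.pos polynomial_on_if_homogeneous)
  also have "V - {x \<in> V. - f x > 0} = {x \<in> V. f x \<ge> 0}" by auto
  finally show ?thesis .
qed

lemma semialgebraic_clique_psd_cone:
  fixes E :: "'n::finite set set"
  shows "semialgebraic_in (graph_matrices E) (clique_psd_cone E)"
proof -
  let ?V = "graph_matrices E"
  have "semialgebraic_in ?V {A \<in> ?V. \<forall>D\<in>\<D>. principal_det D A \<ge> 0}" for \<D> :: "'n set set"
    using finite[of \<D>]
  proof (induction \<D> rule: finite_induct)
    case empty
    \<comment> \<open>With no inequalities the set is all of \<open>?V\<close>, written as the set
      where the constant 0 is nonnegative.\<close>
    show ?case using semialgebraic_in_nonneg[OF homogeneous_on_const[of ?V 0]] by simp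
  next
    case (insert D \<D>)
    have "{A \<in> ?V. \<forall>D\<in>insert D \<D>. principal_det D A \<ge> 0}
        = {A \<in> ?V. principal_det D A \<ge> 0} \<inter> {A \<in> ?V. \<forall>D\<in>\<D>. principal_det D A \<ge> 0}" by auto
    then show ?case
      using semialgebraic_in_Int[OF semialgebraic_in_nonneg[OF homogeneous_on_principal_det] insert.IH]
      by auto
  qed
  from this[of "{D. clique E D}"] show ?thesis
    by (rule back_subst) (auto simp: clique_psd_cone_iff_minors)
qed

section \<open>Convexity, properness, interior and boundary of the cone\<close>

lemma quad_form_lincomb:
  fixes A B :: "real^'n::finite^'n"
  shows "quad_form C (a *\<^sub>R A + b *\<^sub>R B) x = a * quad_form C A x + b * quad_form C B x"
  by (simp add: sum_distrib_left sum.distrib[symmetric] algebra_simps)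

lemma clique_psd_cone_lincomb:
  fixes E :: "'n::finite set set"
  assumes "A \<in> clique_psd_cone E" "B \<in> clique_psd_cone E" "a \<ge> 0" "b \<ge> 0"
  shows "a *\<^sub>R A + b *\<^sub>R B \<in> clique_psd_cone E"
proof -
  have V: "a *\<^sub>R A + b *\<^sub>R B \<in> graph_matrices E"
    using assms by (intro subspace_add subspace_scale subspace_graph_matrices)
      (auto simp: clique_psd_cone_def)
  moreover have "principal_psd C (a *\<^sub>R A + b *\<^sub>R B)" if "clique E C" for C
  proof (rule principal_psdI)
    have "principal_psd C A" "principal_psd C B" using assms that by (auto simp: clique_psd_cone_def)
    then show "quad_form C (a *\<^sub>R A + b *\<^sub>R B) x \<ge> 0" for x
      unfolding quad_form_lincomb using assms(3,4) by (simp add: principal_psdD(2))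
  qed (rule graph_matrices_sym[OF V])
  ultimately show ?thesis by (simp add: clique_psd_cone_def)
qed

lemma convex_clique_psd_cone: "convex (clique_psd_cone (E :: 'n::finite set set))"
  by (simp add: convex_def clique_psd_cone_lincomb)

lemma cone_clique_psd_cone: "cone (clique_psd_cone (E :: 'n::finite set set))"
  using clique_psd_cone_lincomb[where b = 0] by (fastforce simp: cone_def)

lemma clique_psd_cone_proper: "clique_psd_cone (E :: 'n::finite set set) \<subset> graph_matrices E"
proof -
  have "- mat 1 \<in> graph_matrices E"
    by (intro subspace_neg subspace_graph_matrices mat_1_in_graph_matrices)
  moreover have "(- mat 1 :: real^'n^'n) \<notin> clique_psd_cone E"
  proof
    assume "(- mat 1 :: real^'n^'n) \<in> clique_psd_cone E"
    \<comment> \<open>Any vertex serves: singletons are cliques, and the diagonal entry is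
      -1.\<close>
    then have "principal_psd {undefined} (- mat 1 :: real^'n^'n)"
      using clique_singleton[of E undefined] unfolding clique_psd_cone_def by blast
    from principal_psdD(2)[OF this, of "\<lambda>_. 1"] show False by (simp add: mat_def)
  qed
  ultimately show ?thesis by (auto simp: clique_psd_cone_def)
qed

text \<open>Continuity of the finitely many minors makes the left side open in the subspace.\<close>

lemma positive_minors_interior:
  fixes E :: "'n::finite set set"
  shows "{A \<in> graph_matrices E. \<forall>D. clique E D \<longrightarrow> principal_det D A > 0}
    \<subseteq> top_of_set (graph_matrices E) interior_of clique_psd_cone E"
proof (rule interior_of_maximal)
  show "{A \<in> graph_matrices E. \<forall>D. clique E D \<longrightarrow> principal_det D A > 0} \<subseteq> clique_psd_cone E"
    by (auto simp: clique_psd_cone_iff_minors less_imp_le)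
  have "open (\<Inter>D\<in>{D. clique E D}. {A :: real^'n^'n. principal_det D A > 0})"
    by (intro open_INT ballI open_Collect_less continuous_intros) simp
  then have "openin (top_of_set (graph_matrices E))
      (graph_matrices E \<inter> (\<Inter>D\<in>{D. clique E D}. {A. principal_det D A > 0}))"
    by (rule openin_open_Int)
  then show "openin (top_of_set (graph_matrices E))
      {A \<in> graph_matrices E. \<forall>D. clique E D \<longrightarrow> principal_det D A > 0}"
    by (simp add: Int_def)
qed

lemma interior_clique_psd_cone_nonempty:
  "top_of_set (graph_matrices E) interior_of clique_psd_cone (E :: 'n::finite set set) \<noteq> {}"
  using positive_minors_interior[of E] mat_1_in_graph_matrices[of E] by (auto simp: principal_det_mat_1)

text \<open>If no factor vanishes at a point of the cone, the blocks of the maximal cliques are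
  positive definite, so all clique minors are positive and the point is interior.\<close>

lemma clique_poly_eq_0_on_frontier:
  fixes E :: "'n::finite set set"
  assumes X: "X \<in> top_of_set (graph_matrices E) frontier_of clique_psd_cone E"
  shows "clique_poly E X = 0"
proof (rule ccontr)
  assume nz: "clique_poly E X \<noteq> 0"
  have K: "X \<in> clique_psd_cone E"
    using X frontier_of_subset_closedin[OF closedin_clique_psd_cone] by blast
  have "principal_det D X > 0" if D: "clique E D" for D
  proof -
    obtain C where C: "C \<in> maximal_cliques E" "D \<subseteq> C" using clique_in_maximal_clique[OF D] .
    have "principal_det C X \<noteq> 0" using nz C(1) by (simp add: clique_poly_def)
    moreover have "principal_psd C X" using K C(1) by (simp add: clique_psd_cone_iff_maximal)
    ultimately show ?thesis using C(2) by (intro principal_minor_pos)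
  qed
  then have "X \<in> top_of_set (graph_matrices E) interior_of clique_psd_cone E"
    using positive_minors_interior[of E] K by (auto simp: clique_psd_cone_def)
  then show False using X by (simp add: frontier_of_def)
qed

section \<open>Hyperbolicity\<close>

text \<open>For a complex eigenvector \<open>v\<close>, the Hermitian form \<open>w\<close> of the
  block at \<open>v\<close> is real by symmetry and equals \<open>z\<close> times the positive
  square norm of \<open>v\<close>.\<close>

lemma symmetric_eigenvalue_real:
  fixes X :: "real^'n::finite^'n"
  assumes sym: "\<And>i j. i \<in> C \<Longrightarrow> j \<in> C \<Longrightarrow> X $ i $ j = X $ j $ i"
    and "leibniz_det C (\<lambda>i j. complex_of_real (X $ i $ j) - (if i = j then z else 0)) = 0"
  shows "z \<in> \<real>"
proof -
  obtain v k where k: "k \<in> C" "v k \<noteq> 0"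
    and v: "\<And>i. i \<in> C \<Longrightarrow> (\<Sum>j\<in>C. (complex_of_real (X $ i $ j) - (if i = j then z else 0)) * v j) = 0"
    using assms(2) unfolding leibniz_det_eq_0_iff by blast
  have ev: "(\<Sum>j\<in>C. of_real (X $ i $ j) * v j) = z * v i" if "i \<in> C" for i
  proof -
    have "(\<Sum>j\<in>C. (complex_of_real (X $ i $ j) - (if i = j then z else 0)) * v j)
        = (\<Sum>j\<in>C. of_real (X $ i $ j) * v j - (if i = j then z * v i else 0))"
      by (rule sum.cong) (auto simp: algebra_simps)
    then show ?thesis using v[OF that] that by (simp add: sum_subtractf)
  qed
  define w where "w = (\<Sum>i\<in>C. cnj (v i) * (\<Sum>j\<in>C. of_real (X $ i $ j) * v j))"
  have "cnj w = (\<Sum>i\<in>C. \<Sum>j\<in>C. v i * of_real (X $ i $ j) * cnj (v j))"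
    by (simp add: w_def sum_distrib_left mult.assoc)
  also have "\<dots> = (\<Sum>j\<in>C. \<Sum>i\<in>C. v i * of_real (X $ i $ j) * cnj (v j))" by (rule sum.swap)
  also have "\<dots> = w"
    unfolding w_def sum_distrib_left by (intro sum.cong) (auto simp: sym mult_ac)
  finally have "w \<in> \<real>" by (simp add: Reals_cnj_iff)
  have "w = (\<Sum>i\<in>C. z * of_real ((cmod (v i))\<^sup>2))"
    unfolding w_def complex_norm_square by (intro sum.cong refl) (subst ev, simp_all add: mult_ac)
  then have w: "w = z * of_real (\<Sum>i\<in>C. (cmod (v i))\<^sup>2)" by (simp add: sum_distrib_left)
  have "(\<Sum>i\<in>C. (cmod (v i))\<^sup>2) > 0" using k by (intro sum_squares_pos[of k]) auto
  then have "complex_of_real (\<Sum>i\<in>C. (cmod (v i))\<^sup>2) \<noteq> 0"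
    unfolding of_real_eq_0_iff by linarith
  then have "z = w / of_real (\<Sum>i\<in>C. (cmod (v i))\<^sup>2)" unfolding w by (rule nonzero_mult_div_cancel_right[symmetric])
  then show ?thesis using \<open>w \<in> \<real>\<close> by (simp only: Reals_divide Reals_of_real)
qed

lemma hyperbolic_clique_poly:
  fixes E :: "'n::finite set set"
  shows "hyperbolic_along (graph_matrices E) (clique_poly E) (mat 1)"
  unfolding hyperbolic_along_def
proof (intro conjI ballI)
  show "\<exists>d. homogeneous_on (graph_matrices E) d (clique_poly E)"
    using homogeneous_on_clique_poly by blast
  show "mat 1 \<in> graph_matrices E" by (rule mat_1_in_graph_matrices)
  show "clique_poly E (mat 1) > 0" by (simp add: clique_poly_def principal_det_mat_1)
  fix X :: "real^'n^'n" assume X: "X \<in> graph_matrices E"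
  \<comment> \<open>The characteristic matrix over the polynomial ring. Its determinant can be
    evaluated at real \<open>t\<close>, giving the values on the line, and at complex
    \<open>z\<close>, giving a singular complex block at each root.\<close>
  define M where "M = (\<lambda>i j. [:X $ i $ j, if i = j then - 1 else 0:])"
  define u where "u = (\<Prod>C\<in>maximal_cliques E. leibniz_det C M)"
  have "poly u t = clique_poly E (X - t *\<^sub>R mat 1)" for t
  proof -
    have "poly (leibniz_det C M) t = principal_det C (X - t *\<^sub>R mat 1)" for C
      unfolding leibniz_det_def principal_det_def poly_sum poly_mult poly_prod
      by (intro sum.cong refl arg_cong2[where f = "(*)"] prod.cong) (auto simp: M_def mat_def)
    then show ?thesis by (simp add: u_def clique_poly_def poly_prod)
  qed
  moreover have "real_rooted u" unfolding real_rooted_def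
  proof (intro allI impI)
    fix z assume z: "poly (map_poly complex_of_real u) z = 0"
    have "poly (map_poly complex_of_real (leibniz_det C M)) z
        = leibniz_det C (\<lambda>i j. of_real (X $ i $ j) - (if i = j then z else 0))" for C
    proof -
      have "poly (map_poly complex_of_real (M i j)) z = of_real (X $ i $ j) - (if i = j then z else 0)" for i j
        by (simp add: M_def map_poly_pCons)
      moreover have "poly (map_poly complex_of_real (of_int k)) z = of_int k" for k
        by (simp add: of_int_poly map_poly_pCons)
      ultimately show ?thesis
        by (simp add: leibniz_det_def poly_map_of_real_sum poly_map_of_real_mult poly_map_of_real_prod)
    qed
    then obtain C where "leibniz_det C (\<lambda>i j. complex_of_real (X $ i $ j) - (if i = j then z else 0)) = 0"
      using z by (auto simp: u_def poly_map_of_real_prod)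
    then show "z \<in> \<real>" by (rule symmetric_eigenvalue_real[rotated]) (rule graph_matrices_sym[OF X])
  qed
  ultimately show "\<exists>u. (\<forall>t. poly u t = clique_poly E (X - t *\<^sub>R mat 1)) \<and> real_rooted u" by blast
qed

text \<open>The zeros in \<open>t\<close> are the eigenvalues of the blocks of maximal cliques, and
  a block is semidefinite exactly when it has no negative eigenvalue.\<close>

lemma clique_psd_cone_eq_hyp_cone:
  fixes E :: "'n::finite set set"
  shows "clique_psd_cone E = hyp_cone (graph_matrices E) (clique_poly E) (mat 1)"
proof (intro equalityI subsetI)
  fix X assume X: "X \<in> clique_psd_cone E"
  have "t \<ge> 0" if "clique_poly E (t *\<^sub>R mat 1 - X) = 0" for t
  proof (rule ccontr)
    assume "\<not> t \<ge> 0"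
    obtain C where C: "C \<in> maximal_cliques E" "principal_det C (t *\<^sub>R mat 1 - X) = 0"
      using \<open>clique_poly E _ = 0\<close> by (auto simp: clique_poly_def)
    obtain v k where v: "k \<in> C" "v k \<noteq> 0" "\<And>i. i \<in> C \<Longrightarrow> (\<Sum>j\<in>C. (t *\<^sub>R mat 1 - X) $ i $ j * v j) = 0"
      using principal_det_kernel[OF C(2)] by blast
    have "quad_form C ((- 1) *\<^sub>R X + t *\<^sub>R mat 1) v = 0"
      unfolding quad_form_alt using v(3) by simp
    then have "- quad_form C X v + t * (\<Sum>i\<in>C. (v i)\<^sup>2) = 0"
      unfolding quad_form_add_mat by simp
    moreover have "quad_form C X v \<ge> 0"
      using X C(1) by (intro principal_psdD(2)) (simp add: clique_psd_cone_iff_maximal)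
    moreover have "t * (\<Sum>i\<in>C. (v i)\<^sup>2) < 0"
      using sum_squares_pos[of k C v] v \<open>\<not> t \<ge> 0\<close> by (simp add: mult_neg_pos)
    ultimately show False by linarith
  qed
  then show "X \<in> hyp_cone (graph_matrices E) (clique_poly E) (mat 1)"
    using X by (auto simp: hyp_cone_def clique_psd_cone_def)
next
  fix X assume X: "X \<in> hyp_cone (graph_matrices E) (clique_poly E) (mat 1)"
  then have V: "X \<in> graph_matrices E" by (simp add: hyp_cone_def)
  have "principal_psd C X" if C: "C \<in> maximal_cliques E" for C
  proof (rule ccontr)
    assume "\<not> principal_psd C X"
    then obtain l where l: "l < 0" "leibniz_det C (\<lambda>i j. X $ i $ j - (if i = j then l else 0)) = 0"
      using principal_not_psd_eigenvalue[of C X] graph_matrices_sym[OF V] by blast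
    then obtain v k where v: "k \<in> C" "v k \<noteq> 0"
      "\<And>i. i \<in> C \<Longrightarrow> (\<Sum>j\<in>C. (X $ i $ j - (if i = j then l else 0)) * v j) = 0"
      unfolding leibniz_det_eq_0_iff by blast
    have "(\<Sum>j\<in>C. (l *\<^sub>R mat 1 - X) $ i $ j * v j) = 0" if "i \<in> C" for i
    proof -
      have "(\<Sum>j\<in>C. (l *\<^sub>R mat 1 - X) $ i $ j * v j)
          = - (\<Sum>j\<in>C. (X $ i $ j - (if i = j then l else 0)) * v j)"
        unfolding sum_negf[symmetric] by (rule sum.cong) (auto simp: mat_def algebra_simps)
      then show ?thesis using v(3)[OF that] by simp
    qed
    then have "principal_det C (l *\<^sub>R mat 1 - X) = 0"
      using v(1,2) by (auto simp: principal_det_leibniz leibniz_det_eq_0_iff)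
    then have "clique_poly E (l *\<^sub>R mat 1 - X) = 0"
      using C by (auto simp: clique_poly_def intro!: prod_zero)
    then show False using X l(1) by (auto simp: hyp_cone_def)
  qed
  then show "X \<in> clique_psd_cone E" using V by (simp add: clique_psd_cone_iff_maximal)
qed

section \<open>Polynomials vanishing on the boundary\<close>

text \<open>Subtracting any positive multiple of the identity makes the form negative at
  \<open>v\<close>, so points outside the cone lie arbitrarily close to \<open>X\<close>.\<close>

lemma frontier_clique_psd_coneI:
  fixes E :: "'n::finite set set"
  assumes X: "X \<in> clique_psd_cone E" and C: "clique E C" and v: "k \<in> C" "v k \<noteq> 0" "quad_form C X v = 0"
  shows "X \<in> top_of_set (graph_matrices E) frontier_of clique_psd_cone E"
proof -
  let ?V = "graph_matrices E" and ?K = "clique_psd_cone E"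
  have "X \<notin> top_of_set ?V interior_of ?K"
  proof
    assume "X \<in> top_of_set ?V interior_of ?K"
    then obtain T where T: "openin (top_of_set ?V) T" "X \<in> T" "T \<subseteq> ?K"
      by (auto simp: interior_of_def)
    then obtain U where U: "open U" "T = ?V \<inter> U" by (auto simp: openin_open)
    \<comment> \<open>The factor 1 gives the sum the shape of
      \<open>quad_form_add_mat\<close>.\<close>
    have V: "1 *\<^sub>R X + t *\<^sub>R mat 1 \<in> ?V" for t
      using X by (intro subspace_add subspace_scale subspace_graph_matrices mat_1_in_graph_matrices)
        (simp add: clique_psd_cone_def)
    have lim: "((\<lambda>t. 1 *\<^sub>R X + t *\<^sub>R mat 1) \<longlongrightarrow> 1 *\<^sub>R X + 0 *\<^sub>R mat 1) (at_left 0)"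
      by (intro tendsto_intros)
    have "\<forall>\<^sub>F t in at_left (0::real). 1 *\<^sub>R X + t *\<^sub>R mat 1 \<in> U"
      using topological_tendstoD[OF lim, of U] U T by simp
    moreover have "\<forall>\<^sub>F t in at_left (0::real). t \<in> {-1<..<0}" by (rule eventually_at_left_real) simp
    ultimately have "\<forall>\<^sub>F t in at_left (0::real). t < 0 \<and> 1 *\<^sub>R X + t *\<^sub>R mat 1 \<in> ?K"
      by eventually_elim (use V U T in auto)
    then obtain t where t: "t < 0" "1 *\<^sub>R X + t *\<^sub>R mat 1 \<in> ?K"
      using eventually_happens[of _ "at_left (0::real)"] by auto
    have "principal_psd C (1 *\<^sub>R X + t *\<^sub>R mat 1)" using t(2) C by (simp only: clique_psd_cone_def) simp
    from principal_psdD(2)[OF this, of v] have "t * (\<Sum>i\<in>C. (v i)\<^sup>2) \<ge> 0"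
      unfolding quad_form_add_mat v(3) by simp
    then show False using sum_squares_pos[of k C v] v t(1) by (simp add: zero_le_mult_iff)
  qed
  then show ?thesis
    using X closure_of_subset[of ?K "top_of_set ?V"]
    by (auto simp: frontier_of_def clique_psd_cone_def)
qed

lemma vanishes_if_kernel_full_support:
  fixes E :: "'n::finite set set"
  assumes q: "nonzero_vanishing_on_boundary (graph_matrices E) (clique_psd_cone E) q"
    and C: "C \<in> maximal_cliques E" and k: "k \<in> C" and v: "\<And>i. i \<in> C \<Longrightarrow> v i \<noteq> 0"
    and Y: "Y \<in> graph_matrices E" "\<And>i. i \<in> C \<Longrightarrow> (\<Sum>j\<in>C. Y $ i $ j * v j) = 0"
  shows "q Y = 0"
proof (rule ccontr)
  assume qY: "q Y \<noteq> 0"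
  define n where "n = (\<Sum>i\<in>C. (v i)\<^sup>2)"
  \<comment> \<open>\<open>v\<close> extended by 0, so that the off-diagonal entries of
    \<open>X\<close> live inside the clique \<open>C\<close> and respect \<open>E\<close>.\<close>
  define h where "h = (\<lambda>i. if i \<in> C then v i else 0)"
  define X :: "real^'n^'n" where "X = (\<chi> i j. (if i = j then n else 0) - h i * h j)"
  let ?L = "{Y \<in> graph_matrices E. \<forall>i\<in>C. (\<Sum>j\<in>C. Y $ i $ j * v j) = 0}"
  let ?U = "\<Inter>D\<in>{D. clique E D \<and> D \<noteq> C}. {A :: real^'n^'n. principal_det D A > 0}"
  have "X $ i $ j = 0" if "i \<noteq> j" "{i, j} \<notin> E" for i j
    using that maximal_cliquesD(1)[OF C] by (auto simp: X_def h_def clique_def)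
  then have XV: "X \<in> graph_matrices E"
    by (auto simp: graph_matrices_def transpose_def vec_eq_iff X_def)
  have "(\<Sum>j\<in>C. X $ i $ j * v j) = 0" if "i \<in> C" for i
  proof -
    have "(\<Sum>j\<in>C. X $ i $ j * v j) = (\<Sum>j\<in>C. (if j = i then n * v i else 0) - v i * (v j)\<^sup>2)"
      by (rule sum.cong) (use that in \<open>auto simp: X_def h_def algebra_simps power2_eq_square\<close>)
    then show ?thesis using that by (simp add: sum_subtractf sum_distrib_left[symmetric] n_def)
  qed
  then have XL: "X \<in> ?L" using XV by simp
  have quad: "quad_form D X x = n * (\<Sum>i\<in>D. (x i)\<^sup>2) - (\<Sum>i\<in>D. h i * x i)\<^sup>2" for D x
  proof -
    have "(\<Sum>j\<in>D. x i * X $ i $ j * x j) = n * (x i)\<^sup>2 - h i * x i * (\<Sum>j\<in>D. h j * x j)" if "i \<in> D" for i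
    proof -
      have "(\<Sum>j\<in>D. x i * X $ i $ j * x j)
          = (\<Sum>j\<in>D. (if j = i then n * (x i)\<^sup>2 else 0) - h i * x i * (h j * x j))"
        by (rule sum.cong) (auto simp: X_def algebra_simps power2_eq_square)
      then show ?thesis using that by (simp add: sum_subtractf sum_distrib_left)
    qed
    then show ?thesis
      by (simp add: sum_subtractf sum_distrib_left[symmetric] sum_distrib_right[symmetric] power2_eq_square)
  qed
  have minors: "principal_det D X > 0" if D: "clique E D" "D \<noteq> C" for D
  proof (rule principal_pd_det_pos)
    fix x :: "'n \<Rightarrow> real" and l assume l: "l \<in> D" "x l \<noteq> 0"
    \<comment> \<open>A vertex of \<open>C\<close> outside \<open>D\<close> exists by maximality. As
      \<open>v m\<close> is nonzero, the square norm of \<open>v\<close> on \<open>D\<close> is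
      below \<open>n\<close>, which makes the Cauchy-Schwarz bound strict.\<close>
    obtain m where m: "m \<in> C" "m \<notin> D" using D maximal_cliquesD(2)[OF C] by blast
    have "(\<Sum>i\<in>D. (h i)\<^sup>2) = (\<Sum>i\<in>D \<inter> C. (v i)\<^sup>2)"
      by (rule sum.mono_neutral_cong_right) (auto simp: h_def)
    also have "\<dots> < n" unfolding n_def
      by (rule sum_strict_mono2[of _ _ m]) (use m v in auto)
    finally have "(\<Sum>i\<in>D. (h i)\<^sup>2) < n" .
    then have "(\<Sum>i\<in>D. (h i)\<^sup>2) * (\<Sum>i\<in>D. (x i)\<^sup>2) < n * (\<Sum>i\<in>D. (x i)\<^sup>2)"
      using sum_squares_pos[of l D x] l by simp
    then show "quad_form D X x > 0"
      unfolding quad using Cauchy_Schwarz_ineq_sum[of h x D] by linarith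
  qed (rule graph_matrices_sym[OF XV])
  have "convex ?L"
    by (auto simp: convex_def algebra_simps sum.distrib sum_distrib_left[symmetric]
        intro: subspace_add subspace_scale subspace_graph_matrices)
  moreover have "open ?U" by (intro open_INT ballI open_Collect_less continuous_intros) simp
  moreover have "X \<in> ?U" using minors by simp
  moreover have "polynomial_on (graph_matrices E) q" using q by (simp add: nonzero_vanishing_on_boundary_def)
  \<comment> \<open>A nonzero value at \<open>Y\<close> propagates inside the convex set
    \<open>?L\<close> to points as close to \<open>X\<close> as desired, where all cliques other
    than \<open>C\<close> still have positive minors.\<close>
  ultimately obtain Z where Z: "Z \<in> ?L" "Z \<in> ?U" "q Z \<noteq> 0"
    using polynomial_nonzero_nearby[of "graph_matrices E" q ?L X Y ?U] XL Y qY by auto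
  have "principal_det C Z = 0"
    using Z(1) v k by (auto simp: principal_det_leibniz leibniz_det_eq_0_iff)
  then have "principal_det D Z \<ge> 0" if "clique E D" for D
    using Z(2) that by (cases "D = C") (auto intro: less_imp_le)
  then have "Z \<in> clique_psd_cone E" using Z(1) by (simp add: clique_psd_cone_iff_minors)
  moreover have "quad_form C Z v = 0" unfolding quad_form_alt using Z(1) by simp
  ultimately have "Z \<in> top_of_set (graph_matrices E) frontier_of clique_psd_cone E"
    using frontier_clique_psd_coneI[of Z E C k v] maximal_cliquesD(1)[OF C] k v by blast
  then show False using q Z(3) by (simp add: nonzero_vanishing_on_boundary_def)
qed

text \<open>A kernel vector \<open>u\<close> is moved to \<open>u + s w\<close>, which has full support for \<open>s \<noteq> 0\<close> if \<open>w\<close> is the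
  indicator of the zeros of \<open>u\<close>; the block \<open>X\<^sub>C\<close> is corrected in row and column \<open>k\<close> to keep it
  singular.\<close>

lemma vanishes_if_principal_det_0:
  fixes E :: "'n::finite set set"
  assumes q: "nonzero_vanishing_on_boundary (graph_matrices E) (clique_psd_cone E) q"
    and C: "C \<in> maximal_cliques E" and X: "X \<in> graph_matrices E" "principal_det C X = 0"
  shows "q X = 0"
proof -
  let ?V = "graph_matrices E"
  obtain u k where k: "k \<in> C" "u k \<noteq> 0" and u: "\<And>i. i \<in> C \<Longrightarrow> (\<Sum>j\<in>C. X $ i $ j * u j) = 0"
    using principal_det_kernel[OF X(2)] by blast
  define w where "w = (\<lambda>i. if u i = 0 then 1 else 0 :: real)"
  define y where "y = (\<lambda>i. if i \<in> C then \<Sum>j\<in>C. X $ i $ j * w j else 0)"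
  define c where "c = (\<Sum>i\<in>C. w i * y i)"
  \<comment> \<open>Cancels the first order: on \<open>C\<close>, replacing \<open>u\<close> by
    \<open>u + s * w\<close> adds \<open>s\<close> times \<open>y\<close>, the product of the block
    with \<open>w\<close>, and \<open>P\<close> maps \<open>u\<close> to \<open>y\<close> because
    \<open>y\<close> is orthogonal to \<open>u\<close>.\<close>
  define P :: "real^'n^'n" where
    "P = (\<chi> i j. (if j = k then y i / u k else 0) + (if i = k then y j / u k else 0))"
  \<comment> \<open>Since \<open>w k = 0\<close>, \<open>P\<close> maps \<open>w\<close> to
    \<open>c / u k\<close> in row \<open>k\<close> and 0 in the other rows of \<open>C\<close>; this
    entry times \<open>u k\<close> cancels that error of order \<open>s\<^sup>2\<close>.\<close>
  define Q :: "real^'n^'n" where "Q = (\<chi> i j. if i = k \<and> j = k then c / (u k)\<^sup>2 else 0)"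
  define Z where "Z = (\<lambda>s. X - s *\<^sub>R P + s\<^sup>2 *\<^sub>R Q)"
  have "P $ i $ j = 0" if "i \<noteq> j" "{i, j} \<notin> E" for i j
    using that maximal_cliquesD(1)[OF C] k(1) by (auto simp: P_def y_def clique_def insert_commute)
  then have "P \<in> ?V" by (auto simp: graph_matrices_def transpose_def vec_eq_iff P_def)
  moreover have "Q \<in> ?V" by (auto simp: graph_matrices_def transpose_def vec_eq_iff Q_def)
  ultimately have ZV: "Z s \<in> ?V" for s
    unfolding Z_def by (intro subspace_add subspace_diff subspace_scale subspace_graph_matrices X)
  have uy: "(\<Sum>j\<in>C. y j * u j) = 0"
  proof -
    have "(\<Sum>j\<in>C. y j * u j) = (\<Sum>j\<in>C. \<Sum>i\<in>C. w i * (X $ i $ j * u j))"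
      unfolding y_def by (auto simp: sum_distrib_right graph_matrices_sym[OF X(1)] intro!: sum.cong)
    also have "\<dots> = (\<Sum>i\<in>C. w i * (\<Sum>j\<in>C. X $ i $ j * u j))"
      by (subst sum.swap) (simp add: sum_distrib_left)
    finally show ?thesis by (simp add: u)
  qed
  have ker: "(\<Sum>j\<in>C. Z s $ i $ j * (u j + s * w j)) = 0" if i: "i \<in> C" for s i
  proof -
    have yi: "(\<Sum>j\<in>C. X $ i $ j * w j) = y i" using i by (simp add: y_def)
    have wk: "w k = 0" using k by (simp add: w_def)
    have "(\<Sum>j\<in>C. Z s $ i $ j * (u j + s * w j))
        = (\<Sum>j\<in>C. X $ i $ j * u j + s * (X $ i $ j * w j) - (if j = k then s * y i else 0)
            - (if i = k then s / u k * (y j * u j) + s\<^sup>2 / u k * (w j * y j) else 0)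
            + (if j = k then if i = k then s\<^sup>2 * c / u k else 0 else 0))"
      by (rule sum.cong)
        (use k(2) wk in \<open>auto simp: Z_def P_def Q_def field_simps power2_eq_square\<close>)
    also have "\<dots> = 0"
      using i k uy u[OF i] yi
      by (cases "i = k") (simp_all add: sum.distrib sum_subtractf sum_distrib_left[symmetric]
        sum_divide_distrib[symmetric] c_def)
    finally show ?thesis .
  qed
  have zero: "q (Z s) = 0" if "s \<noteq> 0" for s
    by (rule vanishes_if_kernel_full_support[OF q C k(1) _ ZV ker])
      (use that in \<open>auto simp: w_def\<close>)
  have "continuous_on UNIV (\<lambda>s. q (Z s))"
  proof (rule continuous_on_compose2[of ?V q])
    show "continuous_on ?V q"
      using q by (intro polynomial_on_eq_continuous) (simp add: nonzero_vanishing_on_boundary_def)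
    show "continuous_on UNIV Z" unfolding Z_def by (intro continuous_intros)
  qed (use ZV in auto)
  then have "((\<lambda>s. q (Z s)) \<longlongrightarrow> q (Z 0)) (at 0)" by (simp add: continuous_on_def)
  moreover have "((\<lambda>s. q (Z s)) \<longlongrightarrow> 0) (at 0)"
    by (rule tendsto_eventually) (auto simp: eventually_at_filter zero)
  ultimately have "q (Z 0) = 0" by (rule tendsto_unique[rotated]) simp
  then show ?thesis by (simp add: Z_def)
qed

section \<open>Eigenvalues of perturbed diagonal matrices\<close>

text \<open>All terms except the one with the least exponent are divisible by twice that power of 2,
  while this one is not.\<close>

lemma signed_sum_powers_of_2_nz:
  fixes f :: "'a \<Rightarrow> nat" and \<sigma> :: "'a \<Rightarrow> int"
  assumes "finite D" "D \<noteq> {}" "inj_on f D" "\<And>j. j \<in> D \<Longrightarrow> \<bar>\<sigma> j\<bar> = 1"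
  shows "(\<Sum>j\<in>D. \<sigma> j * 2 ^ f j) \<noteq> 0"
proof
  assume sum0: "(\<Sum>j\<in>D. \<sigma> j * 2 ^ f j) = 0"
  obtain k where k: "k \<in> D" "\<And>j. j \<in> D \<Longrightarrow> f k \<le> f j"
    using assms(1,2) ex_min_if_finite[of "f ` D"] by (force simp: not_less)
  have "(2::int) ^ Suc (f k) dvd (\<Sum>j\<in>D - {k}. \<sigma> j * 2 ^ f j)"
  proof (rule dvd_sum)
    fix j assume j: "j \<in> D - {k}"
    then have "f k \<noteq> f j" using assms(3) k(1) by (auto simp: inj_on_def)
    then have "Suc (f k) \<le> f j" using k(2)[of j] j by simp
    then show "2 ^ Suc (f k) dvd \<sigma> j * 2 ^ f j" by (intro dvd_mult le_imp_power_dvd)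
  qed
  moreover have "(\<Sum>j\<in>D - {k}. \<sigma> j * 2 ^ f j) = - (\<sigma> k * 2 ^ f k)"
    using sum0 k(1) assms(1) by (simp add: sum.remove)
  ultimately have "(2::int) ^ Suc (f k) dvd \<sigma> k * 2 ^ f k" by simp
  then have "2 dvd \<sigma> k" by simp
  then show False using assms(4)[OF k(1)] by presburger
qed

text \<open>For a perturbed diagonal matrix, the eigenvalue near \<open>a\<^sub>i\<close> is \<open>a\<^sub>i + \<epsilon>\<^sup>2 s + o(\<epsilon>\<^sup>2)\<close>. Scaling row
  and column \<open>i\<close> by \<open>1/\<epsilon>\<close> makes the limit \<open>\<epsilon> \<rightarrow> 0\<close> of the shifted matrix an arrowhead matrix, whose
  determinant is affine in the shift.\<close>

lemma eigenvalue_second_order: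
  fixes a :: "'n::finite \<Rightarrow> real" and W :: "'n \<Rightarrow> 'n \<Rightarrow> real"
  assumes i: "i \<in> C" and a: "\<And>j. j \<in> C \<Longrightarrow> j \<noteq> i \<Longrightarrow> a j \<noteq> a i"
    and sym: "\<And>j. W j i = W i j" and \<delta>: "\<delta> > 0"
    and s: "s = - (\<Sum>j\<in>C - {i}. (W i j)\<^sup>2 / (a j - a i))"
  defines "M \<equiv> \<lambda>\<epsilon> r j k. if j = k then a j - (a i + \<epsilon>\<^sup>2 * r) else \<epsilon> * W j k"
  shows "\<forall>\<^sub>F \<epsilon> in at_right 0. leibniz_det C (M \<epsilon> (s - \<delta>)) * leibniz_det C (M \<epsilon> (s + \<delta>)) < 0"
proof -
  \<comment> \<open>For nonzero \<epsilon> this is \<open>M\<close> with row and column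
    \<open>i\<close> divided by \<epsilon>: the entry \<open>- (\<epsilon>\<^sup>2 * r)\<close> at
    \<open>(i, i)\<close> becomes \<open>- r\<close>, and off the diagonal only entries outside row
    and column \<open>i\<close> keep a factor \<epsilon>.\<close>
  define N where "N = (\<lambda>\<epsilon> r j k. if j = k then if j = i then - r else a j - (a i + \<epsilon>\<^sup>2 * r)
    else if j = i \<or> k = i then W j k else \<epsilon> * W j k)"
  define p where "p = leibniz_det (C - {i}) (N 0 s)"
  have scaled: "leibniz_det C (M \<epsilon> r) = \<epsilon>\<^sup>2 * leibniz_det C (N \<epsilon> r)" for \<epsilon> r
  proof -
    have "M \<epsilon> r = (\<lambda>j k. (if j = i then \<epsilon> else 1) * (if k = i then \<epsilon> else 1) * N \<epsilon> r j k)"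
      by (auto simp: M_def N_def fun_eq_iff power2_eq_square)
    moreover have "(\<Prod>j\<in>C. if j = i then \<epsilon> else 1) = \<epsilon>" using i by simp
    ultimately show ?thesis
      using leibniz_det_scale[of C "\<lambda>j. if j = i then \<epsilon> else 1" "N \<epsilon> r"] by simp
  qed
  have "leibniz_det C (N 0 s) = 0"
  proof -
    \<comment> \<open>With \<open>v i = 1\<close>, each row \<open>j \<noteq> i\<close> of the
      arrowhead matrix determines \<open>v j\<close>; row \<open>i\<close> then gives 0 precisely by
      the choice of \<open>s\<close>.\<close>
    define v where "v = (\<lambda>j. if j = i then 1 else - (W i j / (a j - a i)))"
    have "(\<Sum>k\<in>C. N 0 s j k * v k) = 0" if j: "j \<in> C" for j
    proof (cases "j = i")
      case True
      have "(\<Sum>k\<in>C. N 0 s i k * v k) = - s + (\<Sum>k\<in>C - {i}. N 0 s i k * v k)"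
        using i by (simp add: sum.remove[of C i] N_def v_def)
      also have "(\<Sum>k\<in>C - {i}. N 0 s i k * v k) = (\<Sum>k\<in>C - {i}. - ((W i k)\<^sup>2 / (a k - a i)))"
        by (rule sum.cong) (auto simp: N_def v_def power2_eq_square)
      finally show ?thesis using True by (simp add: s sum_negf)
    next
      case False
      have "(\<Sum>k\<in>C. N 0 s j k * v k)
          = (\<Sum>k\<in>C. (if k = i then W i j else 0) + (if k = j then - W i j else 0))"
        using False a[OF j] by (intro sum.cong) (auto simp: N_def v_def sym)
      then show ?thesis using i j by (simp add: sum.distrib)
    qed
    then show ?thesis unfolding leibniz_det_eq_0_iff using i by (auto simp: v_def intro!: exI[of _ v])
  qed
  moreover have "N 0 (s + x) = (\<lambda>j k. N 0 s j k + (if j = i \<and> k = i then - x else 0))" for x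
    by (auto simp: N_def fun_eq_iff)
  ultimately have affine: "leibniz_det C (N 0 (s + x)) = - x * p" for x
    using leibniz_det_add_diagonal[OF i, of "N 0 s" "- x"] by (simp add: p_def)
  have p: "p \<noteq> 0"
    unfolding p_def by (rule leibniz_det_diagonal_nz) (auto simp: N_def a)
  have lim: "((\<lambda>\<epsilon>. leibniz_det C (N \<epsilon> r)) \<longlongrightarrow> leibniz_det C (N 0 r)) (at_right 0)" for r
  proof -
    have "((\<lambda>\<epsilon>. N \<epsilon> r j k) \<longlongrightarrow> N 0 r j k) (at_right 0)" for j k
      unfolding N_def by (auto intro!: tendsto_eq_intros)
    then show ?thesis unfolding leibniz_det_def by (intro tendsto_intros)
  qed
  have "((\<lambda>\<epsilon>. leibniz_det C (N \<epsilon> (s - \<delta>)) * leibniz_det C (N \<epsilon> (s + \<delta>)))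
      \<longlongrightarrow> leibniz_det C (N 0 (s - \<delta>)) * leibniz_det C (N 0 (s + \<delta>))) (at_right 0)"
    by (intro tendsto_mult lim)
  \<comment> \<open>The limit is affine with zero \<open>s\<close> and slope \<open>- p\<close>, so
    its values at distance \<delta> on either side are nonzero and opposite.\<close>
  moreover have "leibniz_det C (N 0 (s - \<delta>)) * leibniz_det C (N 0 (s + \<delta>)) < 0"
    using affine[of "- \<delta>"] affine[of \<delta>] p \<delta> by (simp add: mult_less_0_iff zero_less_mult_iff) linarith
  ultimately have "\<forall>\<^sub>F \<epsilon> in at_right 0. leibniz_det C (N \<epsilon> (s - \<delta>)) * leibniz_det C (N \<epsilon> (s + \<delta>)) < 0"
    by (rule order_tendstoD)
  moreover have "\<forall>\<^sub>F \<epsilon> in at_right (0::real). \<epsilon> > 0" by (rule eventually_at_right_less)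
  ultimately show ?thesis
  proof eventually_elim
    case (elim \<epsilon>)
    have "leibniz_det C (M \<epsilon> (s - \<delta>)) * leibniz_det C (M \<epsilon> (s + \<delta>))
        = (\<epsilon>\<^sup>2 * \<epsilon>\<^sup>2) * (leibniz_det C (N \<epsilon> (s - \<delta>)) * leibniz_det C (N \<epsilon> (s + \<delta>)))"
      by (simp add: scaled mult_ac)
    also have "\<dots> < 0" by (rule mult_pos_neg) (use elim in auto)
    finally show ?case .
  qed
qed

text \<open>Common terms cancel, leaving a signed sum of distinct powers over the symmetric
  difference, with signs flipped on \<open>D - C\<close>. The vertex \<open>i\<close>, whose sign is
  unconstrained, is not among them.\<close>

lemma signed_clique_sums_distinct:
  fixes f :: "'n::finite \<Rightarrow> nat" and \<sigma> :: "'n \<Rightarrow> int"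
  assumes "inj f" and \<sigma>: "\<And>j. j \<noteq> i \<Longrightarrow> \<bar>\<sigma> j\<bar> = 1" and "i \<in> C" "i \<in> D" "C \<noteq> D"
  shows "(\<Sum>j\<in>C - {i}. \<sigma> j * 2 ^ f j) \<noteq> (\<Sum>j\<in>D - {i}. \<sigma> j * 2 ^ f j)"
proof -
  let ?g = "\<lambda>j. \<sigma> j * 2 ^ f j" and ?\<tau> = "\<lambda>j. if j \<in> C then \<sigma> j else - \<sigma> j"
  have split: "sum ?g (A - {i}) = sum ?g (A - B) + sum ?g (A \<inter> B - {i})" if "i \<in> B" for A B
    by (subst sum.union_disjoint[symmetric]) (use that in \<open>auto intro!: sum.cong\<close>)
  have "(\<Sum>j\<in>(C - D) \<union> (D - C). ?\<tau> j * 2 ^ f j)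
      = (\<Sum>j\<in>C - D. ?\<tau> j * 2 ^ f j) + (\<Sum>j\<in>D - C. ?\<tau> j * 2 ^ f j)"
    by (rule sum.union_disjoint) auto
  also have "\<dots> = sum ?g (C - D) - sum ?g (D - C)"
    by (simp add: sum_negf[symmetric])
  also have "\<dots> = sum ?g (C - {i}) - sum ?g (D - {i})"
    using split[of D C] split[of C D] assms by (simp add: Int_commute)
  finally have "sum ?g (C - {i}) - sum ?g (D - {i}) = (\<Sum>j\<in>(C - D) \<union> (D - C). ?\<tau> j * 2 ^ f j)" by simp
  moreover have "(\<Sum>j\<in>(C - D) \<union> (D - C). ?\<tau> j * 2 ^ f j) \<noteq> 0"
  proof (rule signed_sum_powers_of_2_nz)
    show "inj_on f (C - D \<union> (D - C))" using assms(1) by (rule inj_on_subset) simp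
    show "\<bar>?\<tau> j\<bar> = 1" if "j \<in> C - D \<union> (D - C)" for j
      using \<sigma>[of j] that assms(3,4) by (cases "j = i") auto
  qed (use assms(5) in auto)
  ultimately show ?thesis by linarith
qed

text \<open>The weights \<open>W\<close> are chosen such that the second order terms of eigenvalues of different
  cliques near the same diagonal entry are different signed sums of powers of 2.\<close>

lemma separated_sign_changes:
  fixes E :: "'n::finite set set"
  defines "P \<equiv> Sigma (maximal_cliques E) (\<lambda>C. C)"
  obtains X l r where "X \<in> graph_matrices E"
    "\<And>C i. (C, i) \<in> P \<Longrightarrow> l (C, i) < r (C, i)"
    "\<And>C i. (C, i) \<in> P \<Longrightarrow> principal_det C (X - l (C, i) *\<^sub>R mat 1) * principal_det C (X - r (C, i) *\<^sub>R mat 1) < 0"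
    "\<And>p p'. p \<in> P \<Longrightarrow> p' \<in> P \<Longrightarrow> p \<noteq> p' \<Longrightarrow> r p < l p' \<or> r p' < (l p :: real)"
proof -
  \<comment> \<open>\<open>a\<close> serves both as the diagonal and as the exponents of the
    weights.\<close>
  obtain a :: "'n \<Rightarrow> nat" where a: "inj a"
    using finite_imp_inj_to_nat_seg[of "UNIV :: 'n set"] by auto
  \<comment> \<open>Squared and divided by \<open>a j - a i\<close>, the absolute value leaves only
    a sign. The factor \<open>2 ^ a i\<close> makes \<open>W\<close> symmetric and is common to all
    terms at a fixed \<open>i\<close>.\<close>
  define W :: "'n \<Rightarrow> 'n \<Rightarrow> real" where "W = (\<lambda>i j. if i \<noteq> j \<and> {i, j} \<in> E
    then sqrt (\<bar>real (a j) - real (a i)\<bar> * 2 ^ a i * 2 ^ a j) else 0)"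
  define s where "s = (\<lambda>(C, i). - (\<Sum>j\<in>C - {i}. (W i j)\<^sup>2 / (real (a j) - real (a i))))"
  have W_sym: "W i j = W j i" for i j by (auto simp: W_def insert_commute abs_minus_commute)
  have s_eq: "s (C, i) = - (2 ^ a i * real_of_int (\<Sum>j\<in>C - {i}. sgn (int (a j) - int (a i)) * 2 ^ a j))"
    if "(C, i) \<in> P" for C i
  proof -
    have "(W i j)\<^sup>2 / (real (a j) - real (a i)) = 2 ^ a i * (sgn (real (a j) - real (a i)) * 2 ^ a j)"
      if "j \<in> C - {i}" for j
    proof -
      have "{i, j} \<in> E" "i \<noteq> j"
        using that \<open>(C, i) \<in> P\<close> maximal_cliquesD(1)[of C E] by (auto simp: P_def clique_def)
      then show ?thesis
        by (cases "a i" "a j" rule: linorder_cases) (auto simp: W_def sgn_if field_simps)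
    qed
    moreover have "sgn (real (a j) - real (a i)) = real_of_int (sgn (int (a j) - int (a i)))" for j
      by (simp add: sgn_if)
    ultimately show ?thesis by (simp add: s_def sum_distrib_left)
  qed
  have s_neq: "s (C, i) \<noteq> s (D, i)" if "(C, i) \<in> P" "(D, i) \<in> P" "C \<noteq> D" for C D i
  proof -
    have "\<bar>sgn (int (a j) - int (a i))\<bar> = 1" if "j \<noteq> i" for j
      using a that by (auto simp: abs_sgn_eq dest: injD)
    then have "(\<Sum>j\<in>C - {i}. sgn (int (a j) - int (a i)) * 2 ^ a j)
        \<noteq> (\<Sum>j\<in>D - {i}. sgn (int (a j) - int (a i)) * 2 ^ a j)"
      using that by (intro signed_clique_sums_distinct[OF a]) (auto simp: P_def)
    then show ?thesis unfolding s_eq[OF that(1)] s_eq[OF that(2)] by (simp del: of_int_sum)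
  qed
  have "finite P" by (simp add: P_def)
  \<comment> \<open>Below half the least gap, intervals of radius \<delta> around different values
    of \<open>s\<close> are disjoint.\<close>
  have "\<forall>\<^sub>F \<delta> in at_right 0. \<forall>p\<in>P. \<forall>p'\<in>P. s p \<noteq> s p' \<longrightarrow> 2 * \<delta> < \<bar>s p - s p'\<bar>"
  proof (intro eventually_ball_finite ballI \<open>finite P\<close>)
    fix p p'
    have "\<forall>\<^sub>F \<delta> in at_right 0. \<delta> < \<bar>s p - s p'\<bar> / 2" if "s p \<noteq> s p'"
      by (rule order_tendstoD(2)[OF tendsto_ident_at]) (use that in simp)
    then show "\<forall>\<^sub>F \<delta> in at_right 0. s p \<noteq> s p' \<longrightarrow> 2 * \<delta> < \<bar>s p - s p'\<bar>"
      by (cases "s p = s p'") (auto elim!: eventually_mono)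
  qed
  moreover have "\<forall>\<^sub>F \<delta> in at_right (0::real). \<delta> > 0" by (rule eventually_at_right_less)
  ultimately have "\<forall>\<^sub>F \<delta> in at_right 0. \<delta> > 0 \<and> (\<forall>p\<in>P. \<forall>p'\<in>P. s p \<noteq> s p' \<longrightarrow> 2 * \<delta> < \<bar>s p - s p'\<bar>)"
    by eventually_elim simp
  from eventually_happens'[OF trivial_limit_at_right_real this] obtain \<delta> where \<delta>: "\<delta> > 0" "\<And>p p'. p \<in> P \<Longrightarrow> p' \<in> P \<Longrightarrow> s p \<noteq> s p' \<Longrightarrow> 2 * \<delta> < \<bar>s p - s p'\<bar>"
    by blast
  define X :: "real \<Rightarrow> real^'n^'n" where "X = (\<lambda>\<epsilon>. \<chi> i j. if i = j then real (a i) else \<epsilon> * W i j)"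
  define l where "l = (\<lambda>\<epsilon> p. real (a (snd p)) + \<epsilon>\<^sup>2 * (s p - \<delta>))"
  define r where "r = (\<lambda>\<epsilon> p. real (a (snd p)) + \<epsilon>\<^sup>2 * (s p + \<delta>))"
  have V: "X \<epsilon> \<in> graph_matrices E" for \<epsilon>
    by (auto simp: graph_matrices_def transpose_def vec_eq_iff X_def W_sym) (simp add: W_def)
  have signs: "\<forall>\<^sub>F \<epsilon> in at_right 0. \<forall>p\<in>P. principal_det (fst p) (X \<epsilon> - l \<epsilon> p *\<^sub>R mat 1)
      * principal_det (fst p) (X \<epsilon> - r \<epsilon> p *\<^sub>R mat 1) < 0"
  proof (intro eventually_ball_finite ballI \<open>finite P\<close>)
    fix p assume p: "p \<in> P"
    obtain C i where pC: "p = (C, i)" by (cases p)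
    have shift: "principal_det C (X \<epsilon> - (real (a i) + \<epsilon>\<^sup>2 * x) *\<^sub>R mat 1) = leibniz_det C
        (\<lambda>j k. if j = k then real (a j) - (real (a i) + \<epsilon>\<^sup>2 * x) else \<epsilon> * W j k)" for \<epsilon> x
      unfolding principal_det_leibniz by (rule leibniz_det_cong) (auto simp: X_def mat_def)
    have i: "i \<in> C" using p by (simp add: P_def pC)
    have neq: "real (a j) \<noteq> real (a i)" if "j \<noteq> i" for j using that by (simp add: inj_eq[OF a])
    have "s (C, i) = - (\<Sum>j\<in>C - {i}. (W i j)\<^sup>2 / (real (a j) - real (a i)))" by (simp add: s_def)
    from eigenvalue_second_order[OF i neq W_sym \<delta>(1) this]
    have "\<forall>\<^sub>F \<epsilon> in at_right 0.
        principal_det C (X \<epsilon> - (real (a i) + \<epsilon>\<^sup>2 * (s (C, i) - \<delta>)) *\<^sub>R mat 1)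
        * principal_det C (X \<epsilon> - (real (a i) + \<epsilon>\<^sup>2 * (s (C, i) + \<delta>)) *\<^sub>R mat 1) < 0"
      unfolding shift .
    then show "\<forall>\<^sub>F \<epsilon> in at_right 0. principal_det (fst p) (X \<epsilon> - l \<epsilon> p *\<^sub>R mat 1)
        * principal_det (fst p) (X \<epsilon> - r \<epsilon> p *\<^sub>R mat 1) < 0"
      by (simp only: l_def r_def pC fst_conv snd_conv)
  qed
  \<comment> \<open>Different diagonal entries separate the intervals once \<epsilon> is small. At a
    common entry both intervals have offsets scaled by \<open>\<epsilon>\<^sup>2\<close>, and the
    choice of \<delta> keeps them apart.\<close>
  have sep: "\<forall>\<^sub>F \<epsilon> in at_right 0. \<forall>p\<in>P. \<forall>p'\<in>P. p \<noteq> p' \<longrightarrow> r \<epsilon> p < l \<epsilon> p' \<or> r \<epsilon> p' < l \<epsilon> p"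
  proof (intro eventually_ball_finite ballI \<open>finite P\<close>)
    fix p p' assume p: "p \<in> P" "p' \<in> P"
    have less: "\<forall>\<^sub>F \<epsilon> in at_right 0. r \<epsilon> p < l \<epsilon> p'" if "a (snd p) < a (snd p')" for p p'
    proof -
      have "((\<lambda>\<epsilon>. r \<epsilon> p - l \<epsilon> p') \<longlongrightarrow> real (a (snd p)) - real (a (snd p'))) (at_right 0)"
        unfolding r_def l_def by (rule tendsto_eq_intros refl | simp)+
      then have "\<forall>\<^sub>F \<epsilon> in at_right 0. r \<epsilon> p - l \<epsilon> p' < 0"
        by (rule order_tendstoD) (use that in simp)
      then show ?thesis by (rule eventually_mono) simp
    qed
    consider "a (snd p) < a (snd p')" | "a (snd p') < a (snd p)" | "snd p = snd p'"
      by (cases "a (snd p)" "a (snd p')" rule: linorder_cases) (simp_all add: inj_eq[OF a])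
    then show "\<forall>\<^sub>F \<epsilon> in at_right 0. p \<noteq> p' \<longrightarrow> r \<epsilon> p < l \<epsilon> p' \<or> r \<epsilon> p' < l \<epsilon> p"
    proof cases
      case 3
      show ?thesis
      proof (cases "p = p'")
        case False
        obtain C D i where eqs: "p = (C, i)" "p' = (D, i)" using 3 by (cases p, cases p') simp
        then have "s p \<noteq> s p'" using p False s_neq[of C i D] by simp
        from \<delta>(2)[OF p this] have gap: "s p + \<delta> < s p' - \<delta> \<or> s p' + \<delta> < s p - \<delta>" by linarith
        show ?thesis
        proof (rule eventually_mono[OF eventually_at_right_less], rule impI)
          fix \<epsilon> :: real assume "0 < \<epsilon>"
          then have "\<epsilon>\<^sup>2 > 0" by simp
          then have "\<epsilon>\<^sup>2 * (s p + \<delta>) < \<epsilon>\<^sup>2 * (s p' - \<delta>) \<or> \<epsilon>\<^sup>2 * (s p' + \<delta>) < \<epsilon>\<^sup>2 * (s p - \<delta>)"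
            using gap by (elim disjE) (simp_all add: mult_strict_left_mono)
          then show "r \<epsilon> p < l \<epsilon> p' \<or> r \<epsilon> p' < l \<epsilon> p"
            by (simp only: l_def r_def 3 add_less_cancel_left)
        qed
      qed simp
    next
      case 1
      show ?thesis by (rule eventually_mono[OF less[OF 1]]) simp
    next
      case 2
      show ?thesis by (rule eventually_mono[OF less[OF 2]]) simp
    qed
  qed
  have "\<forall>\<^sub>F \<epsilon> in at_right (0::real). \<epsilon> > 0" by (rule eventually_at_right_less)
  from eventually_happens'[OF trivial_limit_at_right_real eventually_conj[OF this eventually_conj[OF signs sep]]]
  obtain \<epsilon> where \<epsilon>: "\<epsilon> > 0"
      "\<forall>p\<in>P. principal_det (fst p) (X \<epsilon> - l \<epsilon> p *\<^sub>R mat 1) * principal_det (fst p) (X \<epsilon> - r \<epsilon> p *\<^sub>R mat 1) < 0"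
      "\<forall>p\<in>P. \<forall>p'\<in>P. p \<noteq> p' \<longrightarrow> r \<epsilon> p < l \<epsilon> p' \<or> r \<epsilon> p' < l \<epsilon> p"
    by (elim exE conjE) (rule that)
  show ?thesis
  proof (rule that[of "X \<epsilon>" "l \<epsilon>" "r \<epsilon>"])
    show "l \<epsilon> (C, i) < r \<epsilon> (C, i)" for C i using \<epsilon>(1) \<delta>(1) by (simp add: l_def r_def)
    show "principal_det C (X \<epsilon> - l \<epsilon> (C, i) *\<^sub>R mat 1) * principal_det C (X \<epsilon> - r \<epsilon> (C, i) *\<^sub>R mat 1) < 0"
      if "(C, i) \<in> P" for C i
      using bspec[OF \<epsilon>(2) that] by (simp only: fst_conv)
    show "r \<epsilon> p < l \<epsilon> p' \<or> r \<epsilon> p' < l \<epsilon> p" if "p \<in> P" "p' \<in> P" "p \<noteq> p'" for p p'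
      using \<epsilon>(3)[rule_format, OF that] .
  qed (rule V)
qed

section \<open>Minimality\<close>

lemma degree_ge_if_vanishes_on_boundary:
  fixes E :: "'n::finite set set"
  assumes q: "nonzero_vanishing_on_boundary (graph_matrices E) (clique_psd_cone E) q"
    and m: "polynomial_le_on (graph_matrices E) m q"
  shows "(\<Sum>C\<in>maximal_cliques E. card C) \<le> m"
proof -
  let ?V = "graph_matrices E" and ?P = "Sigma (maximal_cliques E) (\<lambda>C. C)"
  obtain X l r where X: "X \<in> ?V"
    and lr: "\<And>C i. (C, i) \<in> ?P \<Longrightarrow> l (C, i) < r (C, i)"
    and sign: "\<And>C i. (C, i) \<in> ?P \<Longrightarrow>
      principal_det C (X - l (C, i) *\<^sub>R mat 1) * principal_det C (X - r (C, i) *\<^sub>R mat 1) < 0"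
    and sep: "\<And>p p'. p \<in> ?P \<Longrightarrow> p' \<in> ?P \<Longrightarrow> p \<noteq> p' \<Longrightarrow> r p < l p' \<or> r p' < (l p :: real)"
    by (rule separated_sign_changes[of E]) (rule that)
  \<comment> \<open>Strict sign changes are open conditions, so \<open>X\<close> can be moved to a
    \<open>Z\<close> with \<open>q Z \<noteq> 0\<close>; this makes \<open>u\<close> a nonzero
    polynomial whose roots can be counted.\<close>
  let ?U = "\<Inter>p\<in>?P. {Z. principal_det (fst p) (Z - l p *\<^sub>R mat 1) * principal_det (fst p) (Z - r p *\<^sub>R mat 1) < 0}"
  obtain y where y: "y \<in> ?V" "q y \<noteq> 0" using q by (auto simp: nonzero_vanishing_on_boundary_def)
  have "open ?U" by (intro open_INT ballI open_Collect_less continuous_intros) simp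
  moreover have "X \<in> ?U" using sign by auto
  moreover have "polynomial_on ?V q" using m polynomial_on_def by blast
  ultimately obtain Z where Z: "Z \<in> ?V" "Z \<in> ?U" "q Z \<noteq> 0"
    using polynomial_nonzero_nearby[of ?V q ?V X y ?U] X y subspace_graph_matrices[of E]
      subspace_imp_convex by blast
  obtain u where u: "degree u \<le> m" "\<And>t. Z + t *\<^sub>R (- mat 1) \<in> ?V \<Longrightarrow> q (Z + t *\<^sub>R (- mat 1)) = poly u t"
    using polynomial_le_on_line[OF m, of Z "- mat 1"] by blast
  have line: "Z - t *\<^sub>R mat 1 \<in> ?V" for t
    by (intro subspace_diff subspace_scale subspace_graph_matrices mat_1_in_graph_matrices Z(1))
  have qu: "q (Z - t *\<^sub>R mat 1) = poly u t" for t using u(2)[of t] line[of t] by simp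
  have "u \<noteq> 0" using qu[of 0] Z(3) by auto
  have "\<exists>t. l p \<le> t \<and> t \<le> r p \<and> poly u t = 0" if p: "p \<in> ?P" for p
  proof -
    obtain C i where [simp]: "p = (C, i)" by (cases p)
    let ?f = "\<lambda>t. principal_det C (Z - t *\<^sub>R mat 1)"
    have prod: "?f (l p) * ?f (r p) < 0" using Z(2) p by force
    have cont: "continuous_on {l p..r p} ?f" by (intro continuous_intros)
    have le: "l p \<le> r p" using lr[of C i] p by simp
    have "\<exists>t. l p \<le> t \<and> t \<le> r p \<and> ?f t = 0"
    proof (cases "?f (l p) \<le> 0")
      case True
      then show ?thesis using IVT'[of ?f "l p" 0 "r p"] prod cont le by (auto simp: mult_less_0_iff)
    next
      case False
      then show ?thesis using IVT2'[of ?f "r p" 0 "l p"] prod cont le by (auto simp: mult_less_0_iff)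
    qed
    then obtain t where t: "l p \<le> t" "t \<le> r p" "?f t = 0" by blast
    then have "q (Z - t *\<^sub>R mat 1) = 0"
      using p by (intro vanishes_if_principal_det_0[OF q _ line]) auto
    then show ?thesis using t qu by auto
  qed
  then obtain t where t: "\<And>p. p \<in> ?P \<Longrightarrow> l p \<le> t p \<and> t p \<le> r p \<and> poly u (t p) = 0" by metis
  have "inj_on t ?P"
  proof (rule inj_onI, rule ccontr)
    fix p p' assume "p \<in> ?P" "p' \<in> ?P" "t p = t p'" "p \<noteq> p'"
    then show False using t[of p] t[of p'] sep[of p p'] by linarith
  qed
  moreover have "t ` ?P \<subseteq> {x. poly u x = 0}" using t by blast
  ultimately have "card ?P \<le> card {x. poly u x = 0}"
    using card_inj_on_le poly_roots_finite[OF \<open>u \<noteq> 0\<close>] by blast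
  also have "\<dots> \<le> degree u" by (rule card_poly_roots_bound[OF \<open>u \<noteq> 0\<close>])
  also have "\<dots> \<le> m" by (rule u(1))
  finally show ?thesis by simp
qed

theorem theorem3p1:
  fixes E :: "'n::finite set set"
  assumes "simple_graph E" and "chordal E"
  shows "is_hyperbolicity_cone (graph_matrices E) (clique_psd_cone E) \<and>
         is_minimal_polynomial (graph_matrices E) (clique_psd_cone E) (clique_poly E)"
proof
  let ?V = "graph_matrices E" and ?K = "clique_psd_cone E"
  show "is_hyperbolicity_cone ?V ?K"
    unfolding is_hyperbolicity_cone_def
    using hyperbolic_clique_poly clique_psd_cone_eq_hyp_cone by blast
  have hom: "homogeneous_on ?V (\<Sum>C\<in>maximal_cliques E. card C) (clique_poly E)"
    by (rule homogeneous_on_clique_poly)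
  have "clique_poly E (mat 1) \<noteq> 0" by (simp add: clique_poly_def principal_det_mat_1)
  then have "nonzero_vanishing_on_boundary ?V ?K (clique_poly E)"
    unfolding nonzero_vanishing_on_boundary_def
    using polynomial_on_if_homogeneous[OF hom] mat_1_in_graph_matrices clique_poly_eq_0_on_frontier
    by blast
  moreover have "degree_on ?V (clique_poly E) \<le> degree_on ?V q"
    if q: "nonzero_vanishing_on_boundary ?V ?K q" for q
  proof -
    have "degree_on ?V (clique_poly E) \<le> (\<Sum>C\<in>maximal_cliques E. card C)"
      unfolding degree_on_def by (intro Least_le homogeneous_on_imp_polynomial_le_on hom)
    \<comment> \<open>The least degree is attained, so the zero count applies with \<open>m\<close>
      equal to the degree of \<open>q\<close>.\<close>
    also have "polynomial_le_on ?V (degree_on ?V q) q"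
      using q unfolding degree_on_def nonzero_vanishing_on_boundary_def polynomial_on_def
      by (auto intro: LeastI)
    then have "(\<Sum>C\<in>maximal_cliques E. card C) \<le> degree_on ?V q"
      by (rule degree_ge_if_vanishes_on_boundary[OF q])
    finally show ?thesis .
  qed
  ultimately show "is_minimal_polynomial ?V ?K (clique_poly E)"
    unfolding is_minimal_polynomial_def
    using subspace_graph_matrices clique_psd_cone_proper closedin_clique_psd_cone
      semialgebraic_clique_psd_cone convex_clique_psd_cone cone_clique_psd_cone
      interior_clique_psd_cone_nonempty by blast
qed

end
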